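(* Consider the symmetric facilitated exclusion process on the circle $\mathbb{T}_N$ with $k$ particles. Let $\epsilon>0$, let $k=k(N)$ be a sequence of integers with $N/2<k(N)\le N$, and let $m>0$ be a positive integer that does not depend on $N$. There exists a constant $C=C(m)>0$ (not depending on $\epsilon$) such that $$ \max_{\xi\in\mathcal{I}_{N,k}^{m}}P^{\xi}_{C(m)N^{2}\log N}\bigl(\mathcal{G}_{N,k}^{c}\bigr)<\epsilon, $$ for all $N$ sufficiently large depending on $\epsilon$.
   Context: Symmetric facilitated exclusion process (SFEP) on the circle. Let $\mathbb{T}_N=\mathbb{Z}/N\mathbb{Z}$ and $\Omega^\circ_{N,k}=\{\xi\in\{0,1\}^{\mathbb{T}_N}:\sum_{x\in\mathbb{T}_N}\xi(x)=k\}$; $\xi(x)=1$ means a particle at $x$, $\xi(x)=0$ a hole. The SFEP is the continuous-time Markov chain on $\Omega^\circ_{N,k}$ with generator $$\mathcal{L}^\circ f(\xi)=\sum_{x\in\mathbb{T}_N}\tfrac12\xi(x)\xi(x-1)(1-\xi(x+1))[f(\xi^{x,x+1})-f(\xi)]+\sum_{x\in\mathbb{T}_N}\tfrac12\xi(x)\xi(x+1)(1-\xi(x-1))[f(\xi^{x,x-1})-f(\xi)],$$ where $\xi^{x,y}$ is obtained from $\xi$ by exchanging the values at $x$ and $y$. $P_t^\xi$ denotes the law at time $t$ of the SFEP started from $\xi$. The ergodic component is $\mathcal{G}_{N,k}=\{\xi\in\Omega^\circ_{N,k}:\xi(x)+\xi(x+1)\ge 1\ \forall x\in\mathbb{T}_N\}$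 and $\mathcal{G}_{N,k}^c=\Omega^\circ_{N,k}\setminus\mathcal{G}_{N,k}$. Ergodic regions: let $\xi\in\mathcal{G}_{N,k}^c$ and let $[x,y]=\{x,x+1,\ldots,y\}\subset\mathbb{T}_N$ denote a (clockwise) interval. $[x,y]$ is an ergodic interval of $\xi$ if $\xi(x)=1$, $\xi(y)=1$ and $\xi(z)+\xi(z+1)\ge1$ for all $z\in[x,y]$ such that $z+1\in[x,y]$ (in particular a singleton $\{x\}$ with $\xi(x)=1$ is an ergodic interval). The set of ergodic regions of $\xi$ is the smallest set $\{I_1,\ldots,I_n\}$ of ergodic intervals which contain all particles of $\xi$; in particular every ergodic interval is contained in some $I_i$, and $\xi(x)=0$ for all $x\notin I_1\cup\cdots\cup I_n$. For a positive integer $m$, $\mathcal{I}^m_{N,k}$ is the set of $\xi\in\mathcal{G}^c_{N,k}$ for which there exists a set of (distinct) ergodic regions $\{I_1,\ldots,I_{m'}\}$ of $\xi$ with $m'\le m$ and $\sum_{i=1}^{m'}\sum_{x\in I_i}\xi(x)\ge N-k$. (A maximum over an empty set is taken to be $0$.) *)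

theory Defs
  imports Complex_Main "HOL-Library.FuncSet" "HOL-Library.Indicator_Function"
begin

(* Z/NZ is represented by its residues 0, ..., N - 1; all arithmetic on sites is
   taken modulo N. *)

definition torus :: "nat \<Rightarrow> int set" where
  "torus N = {0..<int N}"

definition nxt :: "nat \<Rightarrow> int \<Rightarrow> int" where
  "nxt N x = (x + 1) mod int N"

definition prv :: "nat \<Rightarrow> int \<Rightarrow> int" where
  "prv N x = (x - 1) mod int N"

type_synonym config = "int \<Rightarrow> nat"

definition configs :: "nat \<Rightarrow> nat \<Rightarrow> config set" where
  "configs N k = {\<xi> \<in> torus N \<rightarrow>\<^sub>E {0, 1}. (\<Sum>x\<in>torus N. \<xi> x) = k}"

definition exchange :: "config \<Rightarrow> int \<Rightarrow> int \<Rightarrow> config" where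
  "exchange \<xi> x y = \<xi>(x := \<xi> y, y := \<xi> x)"

definition sfep_generator :: "nat \<Rightarrow> (config \<Rightarrow> real) \<Rightarrow> config \<Rightarrow> real" where
  "sfep_generator N f \<xi> =
     (\<Sum>x\<in>torus N. 1/2 * real (\<xi> x) * real (\<xi> (prv N x)) * (1 - real (\<xi> (nxt N x)))
        * (f (exchange \<xi> x (nxt N x)) - f \<xi>))
   + (\<Sum>x\<in>torus N. 1/2 * real (\<xi> x) * real (\<xi> (nxt N x)) * (1 - real (\<xi> (prv N x)))
        * (f (exchange \<xi> x (prv N x)) - f \<xi>))"

(* The Markov semigroup exp (t L) of the generator L. The state space is finite, so L
   is bounded and the exponential series converges. *)

definition sfep_semigroup :: "nat \<Rightarrow> real \<Rightarrow> (config \<Rightarrow> real) \<Rightarrow> config \<Rightarrow> real" where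
  "sfep_semigroup N t f \<xi> = (\<Sum>n. t ^ n / fact n * (sfep_generator N ^^ n) f \<xi>)"

(* The law at time t of the chain started from \<xi>, as a set function:
   P(\<xi>_t \<in> A) = (exp (t L) 1_A) (\<xi>). *)

definition sfep_law :: "nat \<Rightarrow> real \<Rightarrow> config \<Rightarrow> config set \<Rightarrow> real" where
  "sfep_law N t \<xi> A = sfep_semigroup N t (indicator A) \<xi>"

definition ergodic_component :: "nat \<Rightarrow> nat \<Rightarrow> config set" where
  "ergodic_component N k = {\<xi> \<in> configs N k. \<forall>x\<in>torus N. \<xi> x + \<xi> (nxt N x) \<ge> 1}"

definition nonergodic :: "nat \<Rightarrow> nat \<Rightarrow> config set" where
  "nonergodic N k = configs N k - ergodic_component N k"

(* The clockwise interval from x to y; it is the whole circle when y + 1 = x. *)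

definition cyc_interval :: "nat \<Rightarrow> int \<Rightarrow> int \<Rightarrow> int set" where
  "cyc_interval N x y = (\<lambda>j. (x + j) mod int N) ` {0..(y - x) mod int N}"

definition ergodic_interval :: "nat \<Rightarrow> config \<Rightarrow> int set \<Rightarrow> bool" where
  "ergodic_interval N \<xi> I \<longleftrightarrow>
     (\<exists>x\<in>torus N. \<exists>y\<in>torus N. I = cyc_interval N x y \<and> \<xi> x = 1 \<and> \<xi> y = 1 \<and>
        (\<forall>z\<in>I. nxt N z \<in> I \<longrightarrow> \<xi> z + \<xi> (nxt N z) \<ge> 1))"

definition ergodic_cover :: "nat \<Rightarrow> config \<Rightarrow> int set set \<Rightarrow> bool" where
  "ergodic_cover N \<xi> R \<longleftrightarrow>
     (\<forall>I\<in>R. ergodic_interval N \<xi> I) \<and> {x \<in> torus N. \<xi> x = 1} \<subseteq> \<Union>R"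

(* The smallest family of ergodic intervals containing all particles; smallest means
   least number of intervals. For a configuration outside the ergodic component this
   family is unique: it consists of the ergodic intervals that are maximal under
   inclusion. (Minimality under inclusion of families would not do: the family of all
   singletons of occupied sites is minimal in that sense.) *)

definition is_ergodic_regions :: "nat \<Rightarrow> config \<Rightarrow> int set set \<Rightarrow> bool" where
  "is_ergodic_regions N \<xi> R \<longleftrightarrow> is_arg_min card (ergodic_cover N \<xi>) R"

definition few_regions_configs :: "nat \<Rightarrow> nat \<Rightarrow> nat \<Rightarrow> config set" where
  "few_regions_configs m N k =
     {\<xi> \<in> nonergodic N k. \<exists>R. is_ergodic_regions N \<xi> R \<and>
        (\<exists>J\<subseteq>R. card J \<le> m \<and> int (\<Sum>I\<in>J. \<Sum>x\<in>I. \<xi> x) \<ge> int N - int k)}"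

(* Maximum of f over the finite set A, equal to 0 if A is empty. *)

definition max_over :: "'a set \<Rightarrow> ('a \<Rightarrow> real) \<Rightarrow> real" where
  "max_over A f = (if A = {} then 0 else Max (f ` A))"

end

theory Submission
  imports Defs
begin

text \<open>
  The holes of a configuration keep their cyclic order, and the configuration is determined, up
  to a translation, by the lengths \<open>\<eta> i\<close> of the runs of particles between
  consecutive holes. With \<open>M = N - k\<close> holes, the lengths form an
  \<open>M\<close>-periodic sequence on the integers, and the exclusion process becomes a
  zero-range process: a run of length at least 2 sends a particle to the run on its left or
  right, each at rate 1/2. The configuration is ergodic exactly if no run is empty. The
  generator is \<open>M * (Q - 1)\<close>, where \<open>Q\<close> (\<open>hop_mean\<close>)
  averages over the \<open>2 * M\<close> maps \<open>hop M r d\<close>. Each of these maps is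
  monotone in \<open>\<eta>\<close>, hence removing particles can only increase the probability
  that an empty run survives (\<open>hop_mean_power_antimono\<close>).

  By monotonicity only the particles of the given ergodic regions are kept. They form at most
  \<open>m\<close> blocks (maximal intervals of nonempty runs, up to period) with at least
  \<open>M\<close> particles in total. By monotonicity again, each block dominates the same
  block run on its own, trimmed to at most \<open>M\<close> particles.

  A block on its own stabilises, with all runs of length at most 1, within order
  \<open>N^2 * log N\<close> units of time. Indeed, in the exclusion picture the current is a
  discrete gradient: for any function \<open>\<psi>\<close> the drift of the sum of
  \<open>\<psi>\<close> over the particles is half the sum of the second difference of
  \<open>\<psi>\<close> over those particles that have a neighbouring particle. Take the concave
  function \<open>\<psi> z = K - z^2\<close> with \<open>K\<close> of order \<open>M^2\<close>,
  so that \<open>\<psi>\<close> is comparable to \<open>K\<close> at all reachable places. Let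
  the energy of the block be the sum of \<open>\<psi>\<close> over its particles minus half of
  \<open>\<psi>\<close> at the two holes that bound each of its runs. As long as some run is
  longer than 1, the energy lies between \<open>K / 2\<close> and a multiple of \<open>K\<close>
  times the number of particles in such runs, while its drift is at most a negative multiple of
  that number. So it contracts by a factor \<open>1 - 1 / (M * K)\<close> per averaged step
  (\<open>energy_contracts\<close>), which gives \<open>block_unstable_bound\<close>.

  Once every block has stabilised on its own, it occupies an interval at least as long as its
  number of particles. Either these intervals are disjoint modulo \<open>M\<close>, and then
  they cover everything because they have total length at least \<open>M\<close>
  (\<open>unjoined_blocks_fill\<close>); or two blocks have merged, and the number of blocks has
  dropped. After at most \<open>m\<close> such stages no empty run is left
  (\<open>gap_bound_stages\<close>). Finally the exponential series of the generator is
  rewritten as a Poisson mixture of powers of \<open>Q\<close>, and the geometric bound turns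
  into \<open>exp (- t / (m * K))\<close> (\<open>sfep_law_bound\<close>); the choice
  \<open>t = 24 * m * N^2 * ln N\<close> beats all polynomial prefactors.
\<close>

section \<open>Runs of particles between holes\<close>

text \<open>
  One move of the run process: every site congruent to \<open>r\<close> that holds at least two
  particles sends one of them to its neighbour in direction \<open>d\<close>. Sequences on the
  integers, rather than on residues, carry both the periodic process and a single block on its
  own, and make the two comparable.
\<close>
definition hop :: "nat \<Rightarrow> int \<Rightarrow> int \<Rightarrow> (int \<Rightarrow> nat) \<Rightarrow> int \<Rightarrow> nat" where
  "hop M r d \<eta> i =
     \<eta> i - (if i mod int M = r \<and> 2 \<le> \<eta> i then 1 else 0)
         + (if (i - d) mod int M = r \<and> 2 \<le> \<eta> (i - d) then 1 else 0)"

definition hop_mean :: "nat \<Rightarrow> ((int \<Rightarrow> nat) \<Rightarrow> real) \<Rightarrow> (int \<Rightarrow> nat) \<Rightarrow> real" where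
  "hop_mean M g \<eta> =
     (\<Sum>r\<in>{0..<int M}. g (hop M r 1 \<eta>) + g (hop M r (-1) \<eta>)) / (2 * real M)"

text \<open>
  Invariant sets of the process; inequalities between functions need only be checked on them.
\<close>
definition hop_closed :: "nat \<Rightarrow> (int \<Rightarrow> nat) set \<Rightarrow> bool" where
  "hop_closed M P \<longleftrightarrow>
     (\<forall>\<eta>\<in>P. \<forall>r\<in>{0..<int M}. hop M r 1 \<eta> \<in> P \<and> hop M r (-1) \<eta> \<in> P)"

text \<open>
  The process is attractive: the number of particles left behind is a nondecreasing function of
  the number present, and so is the number sent away. Hence each single map preserves the order,
  without any coupling of random variables.
\<close>
lemma hop_mono:
  assumes "\<eta> \<le> \<eta>'"
  shows "hop M r d \<eta> \<le> hop M r d \<eta>'"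
proof (rule le_funI)
  fix i
  have le: "\<eta> i \<le> \<eta>' i" "\<eta> (i - d) \<le> \<eta>' (i - d)"
    using assms by (auto simp: le_fun_def)
  show "hop M r d \<eta> i \<le> hop M r d \<eta>' i"
    unfolding hop_def by (rule add_mono) (use le in auto)
qed

lemma hop_pos: "0 < \<eta> i \<Longrightarrow> 0 < hop M r d \<eta> i"
  by (auto simp: hop_def)

lemma hop_stable: "(\<And>i. \<eta> i \<le> 1) \<Longrightarrow> hop M r d \<eta> = \<eta>"
proof
  fix i assume a: "\<And>i. \<eta> i \<le> 1"
  show "hop M r d \<eta> i = \<eta> i"
    using a[of i] a[of "i - d"] by (simp add: hop_def)
qed

lemma hop_mean_le:
  assumes "hop_closed M P" "\<eta> \<in> P" "\<And>\<zeta>. \<zeta> \<in> P \<Longrightarrow> g \<zeta> \<le> h \<zeta>"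
  shows "hop_mean M g \<eta> \<le> hop_mean M h \<eta>"
  unfolding hop_mean_def
  by (intro divide_right_mono sum_mono add_mono assms(3))
     (use assms(1,2) in \<open>auto simp: hop_closed_def\<close>)

lemma hop_mean_power_le:
  assumes "hop_closed M P" "\<eta> \<in> P" "\<And>\<zeta>. \<zeta> \<in> P \<Longrightarrow> g \<zeta> \<le> h \<zeta>"
  shows "(hop_mean M ^^ n) g \<eta> \<le> (hop_mean M ^^ n) h \<eta>"
  using assms(2)
proof (induction n arbitrary: \<eta>)
  case (Suc n)
  show ?case
    using hop_mean_le[OF assms(1) Suc.prems Suc.IH] by simp
qed (simp add: assms(3))

lemma hop_mean_const: "M > 0 \<Longrightarrow> hop_mean M (\<lambda>_. c) = (\<lambda>_. c)"
  by (rule ext) (simp add: hop_mean_def)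

lemma hop_mean_power_const: "M > 0 \<Longrightarrow> (hop_mean M ^^ n) (\<lambda>_. c) = (\<lambda>_. c)"
  by (induction n) (simp_all add: hop_mean_const)

lemma hop_mean_add: "hop_mean M (\<lambda>\<eta>. g \<eta> + h \<eta>) = (\<lambda>\<eta>. hop_mean M g \<eta> + hop_mean M h \<eta>)"
  by (rule ext) (simp add: hop_mean_def sum.distrib add_divide_distrib)

lemma hop_mean_cmult: "hop_mean M (\<lambda>\<eta>. c * g \<eta>) = (\<lambda>\<eta>. c * hop_mean M g \<eta>)"
  by (rule ext) (simp add: hop_mean_def sum_distrib_left distrib_left)

lemma hop_mean_power_add:
  "(hop_mean M ^^ n) (\<lambda>\<eta>. g \<eta> + h \<eta>) = (\<lambda>\<eta>. (hop_mean M ^^ n) g \<eta> + (hop_mean M ^^ n) h \<eta>)"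
  by (induction n) (simp_all add: hop_mean_add)

lemma hop_mean_power_cmult:
  "(hop_mean M ^^ n) (\<lambda>\<eta>. c * g \<eta>) = (\<lambda>\<eta>. c * (hop_mean M ^^ n) g \<eta>)"
  by (induction n) (simp_all add: hop_mean_cmult)

lemma hop_mean_sum:
  "finite A \<Longrightarrow> hop_mean M (\<lambda>\<eta>. \<Sum>a\<in>A. g a \<eta>) = (\<lambda>\<eta>. \<Sum>a\<in>A. hop_mean M (g a) \<eta>)"
proof (induction A rule: finite_induct)
  case empty
  show ?case by (rule ext) (simp add: hop_mean_def)
qed (simp add: hop_mean_add)

lemma hop_mean_power_sum:
  "finite A \<Longrightarrow>
    (hop_mean M ^^ n) (\<lambda>\<eta>. \<Sum>a\<in>A. g a \<eta>) = (\<lambda>\<eta>. \<Sum>a\<in>A. (hop_mean M ^^ n) (g a) \<eta>)"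
  by (induction n) (simp_all add: hop_mean_sum)

lemma hop_mean_power_antimono:
  assumes "\<And>\<zeta> \<zeta>'. \<zeta> \<le> \<zeta>' \<Longrightarrow> g \<zeta>' \<le> g \<zeta>" and "\<eta> \<le> \<eta>'"
  shows "(hop_mean M ^^ n) g \<eta>' \<le> (hop_mean M ^^ n) g \<eta>"
  using assms(2)
proof (induction n arbitrary: \<eta> \<eta>')
  case (Suc n)
  show ?case
    unfolding funpow.simps comp_def hop_mean_def[of M "(hop_mean M ^^ n) g"]
    by (intro divide_right_mono sum_mono add_mono Suc.IH hop_mono Suc.prems) simp
qed (simp add: assms(1))

section \<open>A Lyapunov function for a single block\<close>

text \<open>
  With \<open>\<psi> z = K - z^2\<close> this is the sum of \<open>\<psi>\<close> over the sites
  strictly between two consecutive holes \<open>u\<close> and \<open>v\<close>, minus half of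
  \<open>\<psi> u + \<psi> v\<close>: each hole is charged in equal parts to the two runs next
  to it. The closed form is the corresponding cubic polynomial.
\<close>
definition run_energy :: "real \<Rightarrow> real \<Rightarrow> real \<Rightarrow> real" where
  "run_energy K u v = K * (v - u - 2) + (2*u^3 + 6*u^2 + u - 2*v^3 + 6*v^2 - v) / 6"

text \<open>
  Moving the hole \<open>v\<close> one step exchanges it with a particle, so the energy of the
  two adjacent runs changes by \<open>2 * (\<psi> v - \<psi> (v - 1))\<close>.
\<close>
lemma run_energy_shift:
  "run_energy K u (v - 1) + run_energy K (v - 1) w
     = run_energy K u v + run_energy K v w + 2 * (1 - 2 * v)"
  by (simp add: run_energy_def field_simps power2_eq_square power3_eq_cube)

lemma run_energy_shift':
  "run_energy K u (v + 1) + run_energy K (v + 1) w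
     = run_energy K u v + run_energy K v w + 2 * (1 + 2 * v)"
  by (simp add: run_energy_def field_simps power2_eq_square power3_eq_cube)

lemma run_energy_empty:
  "run_energy K v (v + 1) = - (K - v^2 + (K - (v + 1)^2)) / 2"
  by (simp add: run_energy_def field_simps power2_eq_square power3_eq_cube)

lemma run_energy_single: "run_energy K u (u + 2) = 1"
  by (simp add: run_energy_def field_simps power2_eq_square power3_eq_cube)

lemma run_energy_alt:
  "run_energy K u v = K * (v - u - 2) + u^2 + v^2 - (v - u) * (u^2 + u*v + v^2) / 3 - (v - u) / 6"
  by (simp add: run_energy_def field_simps power2_eq_square power3_eq_cube)

text \<open>
  For a run of at least two particles the sum of \<open>\<psi>\<close> over the run dominates
  the two half holes, because \<open>\<psi>\<close> varies by a factor close to 1 on the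
  interval considered; this is where the constant 12 comes from. A run with a single particle
  contributes exactly 1 (\<open>run_energy_single\<close>).
\<close>
lemma run_energy_bounds:
  assumes "3 \<le> v - u" "\<bar>u\<bar> \<le> B" "\<bar>v\<bar> \<le> B" "1 \<le> B" "12 * B^2 \<le> K"
  shows "K / 2 \<le> run_energy K u v" "run_energy K u v \<le> K * (v - u - 1)"
proof -
  have sq: "u^2 \<le> B^2" "v^2 \<le> B^2" "\<bar>u * v\<bar> \<le> B^2" "1 \<le> B^2"
    using assms power_mono[OF assms(2), of 2] power_mono[OF assms(3), of 2]
      mult_mono[OF assms(2,3)] power_mono[OF assms(4), of 2]
    by (auto simp: abs_mult power2_eq_square)
  define q where "q = u^2 + u*v + v^2"
  have q0: "0 \<le> q"
  proof -
    have "q = (u + v/2)^2 + 3/4 * v^2"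
      by (simp add: q_def power2_eq_square field_simps)
    then show ?thesis by simp
  qed
  have q1: "q \<le> 3 * B^2"
    using sq unfolding q_def by linarith
  have alt: "run_energy K u v = K * (v - u - 2) + u^2 + v^2 - (v - u) * q / 3 - (v - u) / 6"
    by (simp add: run_energy_alt q_def)
  have "3 * q \<le> (v - u) * q"
    using assms(1) q0 by (intro mult_right_mono) auto
  then have "u^2 + v^2 - (v - u) * q / 3 \<le> - (u * v)"
    by (simp add: q_def)
  also have "\<dots> \<le> K"
    using sq assms(5) by linarith
  finally have *: "u\<^sup>2 + v\<^sup>2 - (v - u) * q / 3 \<le> K" .
  have "run_energy K u v = K * (v - u - 2) + (u\<^sup>2 + v\<^sup>2 - (v - u) * q / 3) - (v - u) / 6"
    by (simp add: alt)
  also have "\<dots> \<le> K * (v - u - 2) + K - 0"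
    by (rule diff_mono[OF add_left_mono[OF *]]) (use assms(1) in simp)
  also have "\<dots> = K * (v - u - 1)"
    by (simp add: algebra_simps)
  finally show "run_energy K u v \<le> K * (v - u - 1)" .
  have a: "(v - u) * q \<le> (v - u) * (3 * B^2)"
    using assms(1) q1 by (intro mult_left_mono) auto
  have b: "(v - u) * 1 \<le> (v - u) * B^2"
    using assms(1) sq by (intro mult_left_mono) auto
  have c: "(v - u) * (12 * B^2) \<le> (v - u) * K"
    using assms(1,5) by (intro mult_left_mono) auto
  have key: "d / 3 + e / 6 \<le> k * 7 / 72"
    if "d \<le> 3 * x" "e \<le> x" "12 * x \<le> k" for d e k x :: real
    using that by linarith
  have 1: "(v - u) * q / 3 + (v - u) / 6 \<le> K * (v - u) * 7 / 72"
    by (rule key[of _ "(v - u) * B^2"]) (use a b c in \<open>simp_all only: mult_ac mult_1_right mult_1_left\<close>)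
  have 2: "K * 3 \<le> K * (v - u)"
    using assms(1,5) sq by (intro mult_left_mono) auto
  have 3: "0 \<le> u^2 + v^2" by simp
  have 4: "0 \<le> K" using assms(5) sq by linarith
  have key: "K / 2 \<le> d - 2 * K + s - g"
    if "g \<le> d * 7 / 72" "K * 3 \<le> d" "0 \<le> s" "0 \<le> K" for d s g :: real
    using that by linarith
  have "run_energy K u v
      = K * (v - u) - 2 * K + (u^2 + v^2) - ((v - u) * q / 3 + (v - u) / 6)"
    unfolding alt by (simp add: algebra_simps)
  then show "K / 2 \<le> run_energy K u v"
    using key[OF 1 2 3 4] by simp
qed

definition move :: "int \<Rightarrow> int \<Rightarrow> (int \<Rightarrow> nat) \<Rightarrow> int \<Rightarrow> nat" where
  "move i d \<eta> = \<eta>(i := \<eta> i - 1, i + d := \<eta> (i + d) + 1)"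

text \<open>
  An interval of length at most \<open>M\<close> meets each residue class at most once, so a
  move affects at most one of its runs.
\<close>
lemma hop_eq_move:
  assumes "\<And>j. 0 < \<eta> j \<Longrightarrow> a \<le> j \<and> j < b" "b - a \<le> int M"
    and "2 \<le> \<eta> i" "d \<noteq> 0"
  shows "hop M (i mod int M) d \<eta> = move i d \<eta>"
proof
  fix j
  have uniq: "l = i" if "l mod int M = i mod int M" "2 \<le> \<eta> l" for l
  proof -
    have "int M dvd l - i"
      using that(1) by (simp add: mod_eq_dvd_iff)
    moreover have "\<bar>l - i\<bar> < int M"
      using assms(1)[of l] assms(1)[of i] assms(2,3) that(2) by force
    ultimately show ?thesis
      using zdvd_not_zless[of "\<bar>l - i\<bar>" "int M"] by (cases "l = i") auto
  qed
  show "hop M (i mod int M) d \<eta> j = move i d \<eta> j"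
    using uniq[of j] uniq[of "j - d"] assms(3,4) by (auto simp: hop_def move_def)
qed

lemma hop_idle:
  assumes "\<And>i. 2 \<le> \<eta> i \<Longrightarrow> i mod int M \<noteq> r"
  shows "hop M r d \<eta> = \<eta>"
  using assms by (auto simp: hop_def fun_eq_iff)

lemma card_le_sum_nat:
  fixes f :: "'a \<Rightarrow> nat"
  assumes "finite A" "\<And>i. i \<in> A \<Longrightarrow> 0 < f i"
  shows "card A \<le> sum f A"
proof -
  have "card A = (\<Sum>i\<in>A. 1)" by simp
  also have "\<dots> \<le> sum f A" using assms by (intro sum_mono) (simp add: Suc_leI)
  finally show ?thesis .
qed

lemma card_less_sum_nat:
  fixes f :: "'a \<Rightarrow> nat"
  assumes "finite A" "\<And>i. i \<in> A \<Longrightarrow> 0 < f i" "j \<in> A" "2 \<le> f j"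
  shows "card A < sum f A"
proof -
  have "card A = (\<Sum>i\<in>A. 1)" by simp
  also have "\<dots> < sum f A"
    by (rule sum_strict_mono_ex1) (use assms in \<open>force simp: Suc_leI\<close>)+
  finally show ?thesis .
qed

text \<open>
  The position of the hole to the left of run \<open>j\<close> in the exclusion picture. Only
  particles from the site \<open>c - p\<close> on are counted, a site that a block of
  \<open>p\<close> particles around \<open>c\<close> never reaches: a move therefore displaces
  one hole and leaves all others in place.
\<close>
definition hole_pos :: "int \<Rightarrow> nat \<Rightarrow> (int \<Rightarrow> nat) \<Rightarrow> int \<Rightarrow> int" where
  "hole_pos c p \<eta> j = (j - c) + (\<Sum>l\<in>{c - int p..<j}. int (\<eta> l))"

text \<open>
  Empty runs contribute nothing: they lie outside the block, and their polynomial value, at all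
  positions that can be reached, is not positive.
\<close>
definition energy :: "real \<Rightarrow> int \<Rightarrow> nat \<Rightarrow> (int \<Rightarrow> nat) \<Rightarrow> real" where
  "energy K c p \<eta> = (\<Sum>i\<in>{c - int p..<c + int p}.
     if 0 < \<eta> i then run_energy K (hole_pos c p \<eta> i) (hole_pos c p \<eta> (i + 1)) else 0)"

lemma int_move:
  assumes "0 < \<eta> i" "d \<noteq> 0"
  shows "int (move i d \<eta> l) = int (\<eta> l) + (if l = i + d then 1 else 0) - (if l = i then 1 else 0)"
  using assms by (auto simp: move_def)

lemma sum_move:
  assumes "0 < \<eta> i" "d \<noteq> 0" "finite A"
  shows "(\<Sum>l\<in>A. int (move i d \<eta> l))
     = (\<Sum>l\<in>A. int (\<eta> l)) + (if i + d \<in> A then 1 else 0) - (if i \<in> A then 1 else 0)"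
  unfolding int_move[of \<eta> i, OF assms(1,2)] using assms(3)
  by (simp add: sum.distrib sum_subtractf)

lemma hole_pos_move_right:
  assumes "0 < \<eta> i" "c - int p \<le> i"
  shows "hole_pos c p (move i 1 \<eta>) j = hole_pos c p \<eta> j - (if j = i + 1 then 1 else 0)"
  using assms by (auto simp: hole_pos_def sum_move)

lemma hole_pos_move_left:
  assumes "0 < \<eta> i" "c - int p < i"
  shows "hole_pos c p (move i (-1) \<eta>) j = hole_pos c p \<eta> j + (if j = i then 1 else 0)"
  using assms by (auto simp: hole_pos_def sum_move)

lemma hole_pos_step:
  assumes "c - int p \<le> j"
  shows "hole_pos c p \<eta> (j + 1) = hole_pos c p \<eta> j + int (\<eta> j) + 1"
proof -
  have "{c - int p..<j + 1} = insert j {c - int p..<j}"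
    using assms by auto
  then show ?thesis by (simp add: hole_pos_def)
qed

text \<open>
  The interval around the anchor \<open>c\<close> may grow during the evolution; the anchor and
  the number \<open>p\<close> of particles do not change.
\<close>
definition block_on :: "int \<Rightarrow> int \<Rightarrow> int \<Rightarrow> nat \<Rightarrow> (int \<Rightarrow> nat) \<Rightarrow> bool" where
  "block_on a b c p \<eta> \<longleftrightarrow> a \<le> c \<and> c < b \<and> (\<forall>i. 0 < \<eta> i \<longleftrightarrow> a \<le> i \<and> i < b) \<and>
     (\<Sum>i\<in>{a..<b}. \<eta> i) = p"

lemma block_on_length:
  assumes "block_on a b c p \<eta>"
  shows "b - a \<le> int p"
proof -
  have "card {a..<b} \<le> sum \<eta> {a..<b}"
    by (rule card_le_sum_nat) (use assms in \<open>auto simp: block_on_def\<close>)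
  then show ?thesis using assms by (simp add: block_on_def)
qed

lemma block_on_length_less:
  assumes "block_on a b c p \<eta>" "2 \<le> \<eta> i"
  shows "b - a < int p" "a \<le> i" "i < b"
proof -
  have "0 < \<eta> i \<longleftrightarrow> a \<le> i \<and> i < b"
    using assms(1) by (simp add: block_on_def)
  then show "a \<le> i" "i < b"
    using assms(2) by auto
  then have "i \<in> {a..<b}" by simp
  moreover have "0 < \<eta> l" if "l \<in> {a..<b}" for l
    using assms(1) that by (simp add: block_on_def)
  ultimately have "card {a..<b} < sum \<eta> {a..<b}"
    using assms(2) card_less_sum_nat[OF finite_atLeastLessThan_int, of a b \<eta> i] by blast
  also have "\<dots> = p" using assms(1) by (simp add: block_on_def)
  finally show "b - a < int p" by simp
qed

lemma block_on_sum_window: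
  assumes "block_on a b c p \<eta>"
  shows "(\<Sum>i\<in>{c - int p..<c + int p}. \<eta> i) = p"
proof -
  have "a \<le> c" "c < b" using assms by (simp_all add: block_on_def)
  then have sub: "{a..<b} \<subseteq> {c - int p..<c + int p}"
    using block_on_length[OF assms] by auto
  have zero: "\<eta> i = 0" if "i \<notin> {a..<b}" for i
  proof -
    have "0 < \<eta> i \<longleftrightarrow> a \<le> i \<and> i < b"
      using assms by (simp add: block_on_def)
    then show ?thesis using that by auto
  qed
  have "(\<Sum>i\<in>{c - int p..<c + int p}. \<eta> i) = (\<Sum>i\<in>{a..<b}. \<eta> i)"
    using sub zero by (intro sum.mono_neutral_right) blast+
  then show ?thesis using assms by (simp add: block_on_def)
qed

lemma block_on_hole_pos_bound:
  assumes "block_on a b c p \<eta>" "a \<le> j" "j \<le> b"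
  shows "\<bar>hole_pos c p \<eta> j\<bar> \<le> 2 * int p"
proof -
  have j: "c - int p \<le> j" "j \<le> c + int p" "- int p \<le> j - c" "j - c \<le> int p"
    using block_on_length[OF assms(1)] assms by (simp_all add: block_on_def)
  have "(\<Sum>l\<in>{c - int p..<j}. int (\<eta> l)) \<le> (\<Sum>l\<in>{c - int p..<c + int p}. int (\<eta> l))"
    using j by (intro sum_mono2) auto
  also have "\<dots> = int p"
    using block_on_sum_window[OF assms(1)] by (simp flip: of_nat_sum)
  finally have "(\<Sum>l\<in>{c - int p..<j}. int (\<eta> l)) \<le> int p" .
  moreover have "0 \<le> (\<Sum>l\<in>{c - int p..<j}. int (\<eta> l))"
    by (intro sum_nonneg) auto
  ultimately show ?thesis using j unfolding hole_pos_def by linarith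
qed

lemma run_energy_empty_nonpos:
  assumes "\<bar>v\<bar> \<le> B" "\<bar>v + 1\<bar> \<le> B" "B^2 \<le> K"
  shows "run_energy K v (v + 1) \<le> 0"
proof -
  have "v^2 \<le> B^2" "(v + 1)^2 \<le> B^2"
    using assms(1,2) power_mono[of "\<bar>v\<bar>" B 2] power_mono[of "\<bar>v+1\<bar>" B 2] by auto
  then show ?thesis using assms(3) unfolding run_energy_empty by (simp add: field_simps)
qed

lemma sum_two_remove:
  fixes f :: "int \<Rightarrow> real"
  assumes "finite W" "i \<in> W" "j \<in> W" "i \<noteq> j"
  shows "sum f W = f i + f j + sum f (W - {i, j})"
proof -
  have "W = insert i (insert j (W - {i, j}))" using assms by auto
  then have "sum f W = sum f (insert i (insert j (W - {i, j})))" by simp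
  also have "\<dots> = f i + f j + sum f (W - {i, j})"
    using assms by (subst sum.insert; simp)+
  finally show ?thesis .
qed

text \<open>
  Inside the block the change is given by \<open>run_energy_shift\<close>. If the particle
  enters an empty run behind the hole \<open>v\<close>, the energy before the move lacks the
  nonpositive summand \<open>run_energy K v (v + 1)\<close> of that identity, so the change is
  only smaller.
\<close>
lemma energy_move_right:
  assumes blk: "block_on a b c p \<eta>" and i: "2 \<le> \<eta> i"
    and K: "(2 * real p + 1)^2 \<le> K"
  shows "energy K c p (move i 1 \<eta>) \<le> energy K c p \<eta> + 2 * (1 - 2 * real_of_int (hole_pos c p \<eta> (i + 1)))"
proof -
  note len = block_on_length_less[OF blk i]
  have ac: "a \<le> c" "c < b" using blk by (simp_all add: block_on_def)
  have "i + 1 \<le> b" using len by simp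
  let ?W = "{c - int p..<c + int p}"
  have W: "i \<in> ?W" "i + 1 \<in> ?W" using len ac by auto
  define X where "X = hole_pos c p \<eta>"
  define u v w where "u = real_of_int (X i)" and "v = real_of_int (X (i + 1))"
    and "w = real_of_int (X (i + 2))"
  define t where "t = (\<lambda>\<eta> l. if 0 < \<eta> l
    then run_energy K (hole_pos c p \<eta> l) (hole_pos c p \<eta> (l + 1)) else (0::real))"
  have E: "energy K c p \<zeta> = sum (t \<zeta>) ?W" for \<zeta>
    by (simp add: energy_def t_def)
  have pos: "hole_pos c p (move i 1 \<eta>) j = X j - (if j = i + 1 then 1 else 0)" for j
    unfolding X_def using i W by (intro hole_pos_move_right) auto
  have t': "t (move i 1 \<eta>) i = run_energy K u (v - 1)"
      "t (move i 1 \<eta>) (i + 1) = run_energy K (v - 1) w"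
    using i by (simp_all add: t_def pos u_def v_def w_def) (simp_all add: move_def add.commute)
  have t_eq: "t (move i 1 \<eta>) l = t \<eta> l" if "l \<noteq> i" "l \<noteq> i + 1" for l
    using that by (simp add: t_def pos X_def) (simp add: move_def)
  have ti: "t \<eta> i = run_energy K u v"
    using i by (simp add: t_def u_def v_def X_def)
  have ti1: "run_energy K v w \<le> t \<eta> (i + 1)"
  proof (cases "\<eta> (i + 1) = 0")
    case True
    have "X (i + 2) = X (i + 1) + 1"
      using hole_pos_step[of c p "i + 1" \<eta>] True W by (simp add: X_def add.commute)
    then have wv: "w = v + 1" by (simp add: w_def v_def)
    have "\<bar>X (i + 1)\<bar> \<le> 2 * int p"
      unfolding X_def using block_on_hole_pos_bound[OF blk] len by simp
    then have "\<bar>v\<bar> \<le> 2 * real p"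
      unfolding v_def by linarith
    then have "run_energy K v (v + 1) \<le> 0"
      using K by (intro run_energy_empty_nonpos[where B = "2 * real p + 1"]) auto
    then show ?thesis using True wv by (simp add: t_def)
  next
    case False
    then show ?thesis by (simp add: t_def v_def w_def X_def add.commute)
  qed
  have "energy K c p (move i 1 \<eta>)
      = run_energy K u (v - 1) + run_energy K (v - 1) w + sum (t \<eta>) (?W - {i, i + 1})"
    unfolding E by (subst sum_two_remove[of _ i "i + 1"]) (use W t' t_eq in auto)
  also have "\<dots> = run_energy K u v + run_energy K v w + 2 * (1 - 2 * v)
      + sum (t \<eta>) (?W - {i, i + 1})"
    by (simp add: run_energy_shift)
  also have "\<dots> \<le> t \<eta> i + t \<eta> (i + 1) + 2 * (1 - 2 * v) + sum (t \<eta>) (?W - {i, i + 1})"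
    using ti ti1 by simp
  also have "\<dots> = energy K c p \<eta> + 2 * (1 - 2 * v)"
    unfolding E by (subst sum_two_remove[of _ i "i + 1"]) (use W in auto)
  finally show ?thesis by (simp add: v_def X_def)
qed

lemma energy_move_left:
  assumes blk: "block_on a b c p \<eta>" and i: "2 \<le> \<eta> i"
    and K: "(2 * real p + 1)^2 \<le> K"
  shows "energy K c p (move i (-1) \<eta>) \<le> energy K c p \<eta> + 2 * (1 + 2 * real_of_int (hole_pos c p \<eta> i))"
proof -
  note len = block_on_length_less[OF blk i]
  have ac: "a \<le> c" "c < b" using blk by (simp_all add: block_on_def)
  let ?W = "{c - int p..<c + int p}"
  have W: "i \<in> ?W" "i - 1 \<in> ?W" using len ac by auto
  define X where "X = hole_pos c p \<eta>"
  define u v w where "u = real_of_int (X (i - 1))" and "v = real_of_int (X i)"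
    and "w = real_of_int (X (i + 1))"
  define t where "t = (\<lambda>\<eta> l. if 0 < \<eta> l
    then run_energy K (hole_pos c p \<eta> l) (hole_pos c p \<eta> (l + 1)) else (0::real))"
  have E: "energy K c p \<zeta> = sum (t \<zeta>) ?W" for \<zeta>
    by (simp add: energy_def t_def)
  have pos: "hole_pos c p (move i (-1) \<eta>) j = X j + (if j = i then 1 else 0)" for j
    unfolding X_def using i W by (intro hole_pos_move_left) auto
  have t': "t (move i (-1) \<eta>) (i - 1) = run_energy K u (v + 1)"
      "t (move i (-1) \<eta>) i = run_energy K (v + 1) w"
    using i by (simp_all add: t_def pos u_def v_def w_def) (simp_all add: move_def add.commute)
  have t_eq: "t (move i (-1) \<eta>) l = t \<eta> l" if "l \<noteq> i" "l \<noteq> i - 1" for l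
    using that by (simp add: t_def pos X_def) (simp add: move_def)
  have ti: "t \<eta> i = run_energy K v w"
    using i by (simp add: t_def w_def v_def X_def)
  have ti1: "run_energy K u v \<le> t \<eta> (i - 1)"
  proof (cases "\<eta> (i - 1) = 0")
    case True
    have "X i = X (i - 1) + 1"
      using hole_pos_step[of c p "i - 1" \<eta>] True W by (simp add: X_def)
    then have vu: "v = u + 1" by (simp add: u_def v_def)
    have "\<bar>X i\<bar> \<le> 2 * int p"
      unfolding X_def using block_on_hole_pos_bound[OF blk] len by simp
    then have "\<bar>v\<bar> \<le> 2 * real p"
      unfolding v_def by linarith
    then have "run_energy K u (u + 1) \<le> 0"
      using K vu by (intro run_energy_empty_nonpos[where B = "2 * real p + 1"]) auto
    then show ?thesis using True vu by (simp add: t_def)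
  next
    case False
    then show ?thesis by (simp add: t_def v_def u_def X_def)
  qed
  have "energy K c p (move i (-1) \<eta>)
      = run_energy K u (v + 1) + run_energy K (v + 1) w + sum (t \<eta>) (?W - {i - 1, i})"
    unfolding E by (subst sum_two_remove[of _ "i - 1" i]) (use W t' t_eq in auto)
  also have "\<dots> = run_energy K u v + run_energy K v w + 2 * (1 + 2 * v)
      + sum (t \<eta>) (?W - {i - 1, i})"
    by (simp add: run_energy_shift')
  also have "\<dots> \<le> t \<eta> (i - 1) + t \<eta> i + 2 * (1 + 2 * v) + sum (t \<eta>) (?W - {i - 1, i})"
    using ti ti1 by simp
  also have "\<dots> = energy K c p \<eta> + 2 * (1 + 2 * v)"
    unfolding E by (subst sum_two_remove[of _ "i - 1" i]) (use W in auto)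
  finally show ?thesis by (simp add: v_def X_def)
qed

definition block :: "int \<Rightarrow> nat \<Rightarrow> (int \<Rightarrow> nat) set" where
  "block c p = {\<eta>. \<exists>a b. block_on a b c p \<eta>}"

lemma block_on_pos_iff: "block_on a b c p \<eta> \<Longrightarrow> 0 < \<eta> i \<longleftrightarrow> a \<le> i \<and> i < b"
  by (simp add: block_on_def)

lemma block_on_move:
  assumes blk: "block_on a b c p \<eta>" and i: "2 \<le> \<eta> i" and d: "d = 1 \<or> d = -1"
  shows "block_on (min a (i + d)) (max b (i + d + 1)) c p (move i d \<eta>)"
proof -
  note len = block_on_length_less[OF blk i]
  let ?a = "min a (i + d)" and ?b = "max b (i + d + 1)"
  have d0: "d \<noteq> 0" using d by auto
  have "a \<le> c" "c < b" using blk by (simp_all add: block_on_def)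
  then have 1: "?a \<le> c" "c < ?b" by auto
  have 2: "0 < move i d \<eta> l \<longleftrightarrow> ?a \<le> l \<and> l < ?b" for l
  proof -
    have "0 < move i d \<eta> l \<longleftrightarrow> 0 < \<eta> l \<or> l = i + d"
      using i by (auto simp: move_def)
    then show ?thesis
      using block_on_pos_iff[OF blk, of l] len d by auto
  qed
  have 3: "sum (move i d \<eta>) {?a..<?b} = p"
  proof -
    have "int (sum (move i d \<eta>) {?a..<?b}) = (\<Sum>l\<in>{?a..<?b}. int (\<eta> l))"
      using i d0 len unfolding of_nat_sum by (subst sum_move) auto
    also have "\<dots> = (\<Sum>l\<in>{a..<b}. int (\<eta> l))"
    proof (rule sum.mono_neutral_right)
      show "\<forall>l\<in>{?a..<?b} - {a..<b}. int (\<eta> l) = 0"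
      proof
        fix l assume "l \<in> {?a..<?b} - {a..<b}"
        then have "\<not> 0 < \<eta> l" using block_on_pos_iff[OF blk, of l] by simp
        then show "int (\<eta> l) = 0" by simp
      qed
    qed auto
    also have "\<dots> = int p"
      using blk by (simp add: block_on_def flip: of_nat_sum)
    finally show ?thesis by (simp only: of_nat_eq_iff)
  qed
  show ?thesis unfolding block_on_def using 1 2 3 by blast
qed

lemma block_hop_move:
  assumes blk: "block_on a b c p \<eta>" and "p \<le> M" "2 \<le> \<eta> i" "d \<noteq> 0"
  shows "hop M (i mod int M) d \<eta> = move i d \<eta>"
proof (rule hop_eq_move[of \<eta> a b])
  show "a \<le> j \<and> j < b" if "0 < \<eta> j" for j
    using block_on_pos_iff[OF blk, of j] that by simp
  show "b - a \<le> int M"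
    using block_on_length[OF blk] assms(2) by linarith
qed (rule assms(3,4))+

lemma block_hop_cases:
  assumes blk: "block_on a b c p \<eta>" and "p \<le> M" and d: "d = 1 \<or> d = -1"
  obtains "hop M r d \<eta> = \<eta>" | i where "2 \<le> \<eta> i" "i mod int M = r" "hop M r d \<eta> = move i d \<eta>"
proof (cases "\<exists>i. 2 \<le> \<eta> i \<and> i mod int M = r")
  case True
  then obtain i where i: "2 \<le> \<eta> i" "i mod int M = r" by blast
  have "hop M (i mod int M) d \<eta> = move i d \<eta>"
    by (rule block_hop_move[OF blk]) (use assms(2) d i(1) in auto)
  then show ?thesis using i that(2) by blast
next
  case False
  then have "hop M r d \<eta> = \<eta>" by (intro hop_idle) blast
  then show ?thesis by (rule that(1))
qed

lemma hop_closed_block: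
  assumes "p \<le> M"
  shows "hop_closed M (block c p)"
proof -
  have "hop M r d \<eta> \<in> block c p" if "\<eta> \<in> block c p" and d: "d = 1 \<or> d = -1" for \<eta> r d
  proof -
    obtain a b where blk: "block_on a b c p \<eta>"
      using \<open>\<eta> \<in> block c p\<close> by (auto simp: block_def)
    show ?thesis
    proof (rule block_hop_cases[OF blk assms d, of r])
      assume "hop M r d \<eta> = \<eta>"
      then show ?thesis using that by simp
    next
      fix i assume "2 \<le> \<eta> i" "hop M r d \<eta> = move i d \<eta>"
      then show ?thesis using block_on_move[OF blk _ d, of i] unfolding block_def by auto
    qed
  qed
  then show ?thesis unfolding hop_closed_def by blast
qed

lemma block_energy_term:
  assumes blk: "block_on a b c p \<eta>" and K: "12 * (2 * real p + 1)^2 \<le> K"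
    and i: "0 < \<eta> i"
  defines "e \<equiv> run_energy K (hole_pos c p \<eta> i) (hole_pos c p \<eta> (i + 1))"
  shows "\<eta> i = 1 \<Longrightarrow> e = 1" "2 \<le> \<eta> i \<Longrightarrow> K / 2 \<le> e" "2 \<le> \<eta> i \<Longrightarrow> e \<le> K * real (\<eta> i)"
proof -
  have ab: "a \<le> i" "i < b" using block_on_pos_iff[OF blk, of i] i by simp_all
  have "c - int p \<le> i"
    using block_on_length[OF blk] ab blk by (simp add: block_on_def)
  then have v: "real_of_int (hole_pos c p \<eta> (i + 1)) = real_of_int (hole_pos c p \<eta> i) + real (\<eta> i) + 1"
    using hole_pos_step[of c p i \<eta>] by simp
  have "\<bar>hole_pos c p \<eta> i\<bar> \<le> 2 * int p" "\<bar>hole_pos c p \<eta> (i + 1)\<bar> \<le> 2 * int p"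
    using block_on_hole_pos_bound[OF blk] ab by auto
  then have bnd: "\<bar>real_of_int (hole_pos c p \<eta> i)\<bar> \<le> 2 * real p + 1"
      "\<bar>real_of_int (hole_pos c p \<eta> (i + 1))\<bar> \<le> 2 * real p + 1"
    by linarith+
  show "e = 1" if "\<eta> i = 1"
    unfolding e_def v that using run_energy_single[of K "real_of_int (hole_pos c p \<eta> i)"] by (simp add: add.commute)
  show "K / 2 \<le> e" "e \<le> K * real (\<eta> i)" if "2 \<le> \<eta> i"
    unfolding e_def
    using run_energy_bounds[OF _ bnd _ K] that v by auto
qed

lemma block_energy_bounds:
  assumes blk: "block_on a b c p \<eta>" and K: "12 * (2 * real p + 1)^2 \<le> K"
  shows "0 \<le> energy K c p \<eta>"
    and "2 \<le> \<eta> j \<Longrightarrow> K / 2 \<le> energy K c p \<eta>"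
    and "energy K c p \<eta> \<le> K * (\<Sum>i\<in>{i\<in>{a..<b}. 2 \<le> \<eta> i}. real (\<eta> i)) + real p"
    and "energy K c p \<eta> \<le> 2 * K * real p"
proof -
  let ?W = "{c - int p..<c + int p}"
  define t where "t = (\<lambda>l. if 0 < \<eta> l
    then run_energy K (hole_pos c p \<eta> l) (hole_pos c p \<eta> (l + 1)) else (0::real))"
  have E: "energy K c p \<eta> = sum t ?W"
    by (simp add: energy_def t_def)
  have K1: "1 \<le> K"
  proof -
    have "1 \<le> (2 * real p + 1)^2" by (simp add: one_le_power)
    then show ?thesis using K by linarith
  qed
  have tm: "0 \<le> t l" "t l \<le> (if 2 \<le> \<eta> l then K * real (\<eta> l) else 0) + real (\<eta> l)"
    "2 \<le> \<eta> l \<Longrightarrow> K / 2 \<le> t l" for l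
  proof -
    consider "\<eta> l = 0" | "\<eta> l = 1" | "2 \<le> \<eta> l" by linarith
    then have "0 \<le> t l \<and> t l \<le> (if 2 \<le> \<eta> l then K * real (\<eta> l) else 0) + real (\<eta> l)
        \<and> (2 \<le> \<eta> l \<longrightarrow> K / 2 \<le> t l)"
    proof cases
      case 1 then show ?thesis by (simp add: t_def)
    next
      case 2 then show ?thesis using block_energy_term(1)[OF blk K, of l] by (simp add: t_def)
    next
      case 3 then show ?thesis using block_energy_term(2,3)[OF blk K, of l] K1 by (simp add: t_def)
    qed
    then show "0 \<le> t l" "t l \<le> (if 2 \<le> \<eta> l then K * real (\<eta> l) else 0) + real (\<eta> l)"
      "2 \<le> \<eta> l \<Longrightarrow> K / 2 \<le> t l" by auto
  qed
  show "0 \<le> energy K c p \<eta>"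
    unfolding E using tm by (intro sum_nonneg)
  have win: "{a..<b} \<subseteq> ?W"
  proof -
    have "a \<le> c" "c < b" using blk by (simp_all add: block_on_def)
    then show ?thesis using block_on_length[OF blk] by auto
  qed
  show "K / 2 \<le> energy K c p \<eta>" if "2 \<le> \<eta> j"
  proof -
    have "j \<in> ?W" using block_on_length_less[OF blk that] win by auto
    then have "t j \<le> sum t ?W" using tm by (intro member_le_sum) auto
    then show ?thesis unfolding E using tm(3)[OF that] by simp
  qed
  have "sum t ?W \<le> (\<Sum>l\<in>?W. (if 2 \<le> \<eta> l then K * real (\<eta> l) else 0) + real (\<eta> l))"
    by (intro sum_mono tm)
  also have "\<dots> = (\<Sum>l\<in>?W. if 2 \<le> \<eta> l then K * real (\<eta> l) else 0) + real p"
    using block_on_sum_window[OF blk] by (simp add: sum.distrib flip: of_nat_sum)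
  also have "(\<Sum>l\<in>?W. if 2 \<le> \<eta> l then K * real (\<eta> l) else 0)
      = K * (\<Sum>i\<in>{i\<in>{a..<b}. 2 \<le> \<eta> i}. real (\<eta> i))"
    unfolding sum_distrib_left
  proof (rule sum.mono_neutral_cong_right)
    show "{i \<in> {a..<b}. 2 \<le> \<eta> i} \<subseteq> ?W" using win by auto
    show "\<forall>i\<in>?W - {i \<in> {a..<b}. 2 \<le> \<eta> i}. (if 2 \<le> \<eta> i then K * real (\<eta> i) else 0) = 0"
      using block_on_length_less(2,3)[OF blk] by auto
  qed auto
  finally show main: "energy K c p \<eta> \<le> K * (\<Sum>i\<in>{i\<in>{a..<b}. 2 \<le> \<eta> i}. real (\<eta> i)) + real p"
    unfolding E .
  have "(\<Sum>i\<in>{i\<in>{a..<b}. 2 \<le> \<eta> i}. real (\<eta> i)) \<le> (\<Sum>i\<in>{a..<b}. real (\<eta> i))"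
    by (intro sum_mono2) auto
  also have "\<dots> = real p" using blk by (simp add: block_on_def flip: of_nat_sum)
  finally have "K * (\<Sum>i\<in>{i\<in>{a..<b}. 2 \<le> \<eta> i}. real (\<eta> i)) \<le> K * real p"
    using K1 by (intro mult_left_mono) auto
  moreover have "real p \<le> K * real p" using K1 mult_right_mono[of 1 K "real p"] by simp
  ultimately show "energy K c p \<eta> \<le> 2 * K * real p"
    using main by linarith
qed

text \<open>
  The two moves out of a run with holes \<open>u\<close> and \<open>v\<close> together
  contribute \<open>2 * (1 - 2 * v) + 2 * (1 + 2 * u)\<close>, that is \<open>- 4\<close> times
  the length of the run. This is the gradient property: the first differences of
  \<open>\<psi>\<close> at the two ends add up to a sum of second differences.
\<close>
lemma energy_drift:
  assumes blk: "block_on a b c p \<eta>" and pM: "p \<le> M" and K: "12 * (2 * real p + 1)^2 \<le> K"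
  shows "(\<Sum>r\<in>{0..<int M}. (energy K c p (hop M r 1 \<eta>) - energy K c p \<eta>)
            + (energy K c p (hop M r (-1) \<eta>) - energy K c p \<eta>))
     \<le> - 4 * (\<Sum>i\<in>{i\<in>{a..<b}. 2 \<le> \<eta> i}. real (\<eta> i))"
proof -
  let ?E = "energy K c p"
  let ?S = "{i\<in>{a..<b}. 2 \<le> \<eta> i}"
  define D where "D = (\<lambda>r. (?E (hop M r 1 \<eta>) - ?E \<eta>) + (?E (hop M r (-1) \<eta>) - ?E \<eta>))"
  have K': "(2 * real p + 1)^2 \<le> K"
    using K zero_le_power2[of "2 * real p + 1"] by linarith
  have zero: "D r = 0" if "r \<notin> (\<lambda>i. i mod int M) ` ?S" for r
  proof -
    have "i mod int M \<noteq> r" if "2 \<le> \<eta> i" for i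
      using \<open>r \<notin> _\<close> that block_on_length_less(2,3)[OF blk that] by auto
    then have "hop M r d \<eta> = \<eta>" for d by (intro hop_idle)
    then show ?thesis by (simp add: D_def)
  qed
  have inj: "inj_on (\<lambda>i. i mod int M) ?S"
  proof (rule inj_onI)
    fix i j assume ij: "i \<in> ?S" "j \<in> ?S" "i mod int M = j mod int M"
    have "int M dvd i - j" using ij(3) by (simp add: mod_eq_dvd_iff)
    moreover have "\<bar>i - j\<bar> < int M"
      using ij block_on_length[OF blk] pM by auto
    ultimately show "i = j"
      using zdvd_not_zless[of "\<bar>i - j\<bar>" "int M"] by (cases "i = j") auto
  qed
  have M: "0 < int M" if "i \<in> ?S" for i
    using that block_on_length[OF blk] pM by auto
  have "sum D {0..<int M} = sum D ((\<lambda>i. i mod int M) ` ?S)"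
    using zero M by (intro sum.mono_neutral_right) (auto intro!: pos_mod_bound)
  also have "\<dots> = (\<Sum>i\<in>?S. D (i mod int M))"
    using inj by (simp add: sum.reindex)
  also have "\<dots> \<le> (\<Sum>i\<in>?S. - 4 * real (\<eta> i))"
  proof (rule sum_mono)
    fix i assume i: "i \<in> ?S"
    then have i2: "2 \<le> \<eta> i" by simp
    have hop: "hop M (i mod int M) d \<eta> = move i d \<eta>" if "d \<noteq> 0" for d
      by (rule block_hop_move[OF blk pM i2 that])
    have "c - int p \<le> i"
      using block_on_length_less[OF blk i2] blk by (simp add: block_on_def)
    then have "real_of_int (hole_pos c p \<eta> (i + 1)) = real_of_int (hole_pos c p \<eta> i) + real (\<eta> i) + 1"
      using hole_pos_step[of c p i \<eta>] by simp
    then show "D (i mod int M) \<le> - 4 * real (\<eta> i)"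
      unfolding D_def
      using energy_move_right[OF blk i2 K'] energy_move_left[OF blk i2 K'] hop[of 1] hop[of "-1"]
      by simp
  qed
  also have "\<dots> = - 4 * (\<Sum>i\<in>?S. real (\<eta> i))"
    by (simp add: sum_distrib_left)
  finally show ?thesis by (simp add: D_def)
qed

text \<open>
  The energy is at most \<open>K * A + p\<close>, where \<open>A\<close> counts the particles in
  long runs, and the changes over all moves add up to at most \<open>- 4 * A\<close>. As long as
  some run is long, \<open>A\<close> is at least 1, so that the term \<open>p\<close>, being at
  most \<open>K\<close>, is absorbed into \<open>K * A\<close>.
\<close>
lemma energy_contracts:
  assumes blk: "block_on a b c p \<eta>" and pM: "p \<le> M" and K: "12 * (2 * real p + 1)^2 \<le> K"
    and j: "2 \<le> \<eta> j"
  shows "hop_mean M (energy K c p) \<eta> \<le> (1 - 1 / (real M * K)) * energy K c p \<eta>"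
proof -
  let ?E = "energy K c p"
  define A where "A = (\<Sum>i\<in>{i\<in>{a..<b}. 2 \<le> \<eta> i}. real (\<eta> i))"
  have M: "0 < real M"
    using block_on_length_less[OF blk j] pM by simp
  have "finite {i\<in>{a..<b}. 2 \<le> \<eta> i}" by (rule finite_subset[of _ "{a..<b}"]) auto
  then have "real (\<eta> j) \<le> A"
    unfolding A_def using block_on_length_less[OF blk j] j by (intro member_le_sum) auto
  then have A: "1 \<le> A" using j by linarith
  have Kp: "real p \<le> K" "1 \<le> K"
  proof -
    have "(2 * real p + 1) * 1 \<le> (2 * real p + 1) * (2 * real p + 1)"
      by (intro mult_left_mono) auto
    then have "2 * real p + 1 \<le> (2 * real p + 1)^2" by (simp add: power2_eq_square)
    then show "real p \<le> K" "1 \<le> K" using K by linarith+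
  qed
  have "?E \<eta> \<le> K * A + K"
    using block_energy_bounds(3)[OF blk K] Kp unfolding A_def by linarith
  also have "\<dots> \<le> 2 * (K * A)" using A Kp mult_left_mono[of 1 A K] by simp
  finally have EA: "?E \<eta> / K \<le> 2 * A" using Kp by (simp add: field_simps)
  have "2 * real M * (hop_mean M ?E \<eta> - ?E \<eta>)
    = (\<Sum>r\<in>{0..<int M}. (?E (hop M r 1 \<eta>) - ?E \<eta>) + (?E (hop M r (-1) \<eta>) - ?E \<eta>))"
    using M by (simp add: hop_mean_def sum.distrib sum_subtractf field_simps)
  also have "\<dots> \<le> - 4 * A"
    unfolding A_def by (rule energy_drift[OF blk pM K])
  also have "\<dots> \<le> - 2 * (?E \<eta> / K)" using EA by simp
  finally have "real M * (hop_mean M ?E \<eta> - ?E \<eta>) \<le> - (?E \<eta> / K)" by simp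
  then show ?thesis using M Kp by (simp add: field_simps)
qed

definition unstable :: "(int \<Rightarrow> nat) \<Rightarrow> real" where
  "unstable \<eta> = (if \<exists>i. 2 \<le> \<eta> i then 1 else 0)"

text \<open>
  A stable block keeps a positive energy forever, so the contraction is applied to the energy
  set to 0 on stable blocks, which is still contracted because stable blocks do not move.
\<close>
lemma block_unstable_bound:
  assumes \<eta>: "\<eta> \<in> block c p" and pM: "p \<le> M" and M: "0 < M" and K: "12 * (2 * real M + 1)^2 \<le> K"
  shows "(hop_mean M ^^ n) unstable \<eta> \<le> 4 * real M * (1 - 1 / (real M * K)) ^ n"
proof -
  define \<rho> where "\<rho> = 1 / (real M * K)"
  \<comment> \<open>The energy killed at the moment of stabilisation.\<close>
  define W where "W = (\<lambda>\<zeta>. if \<exists>i. 2 \<le> \<zeta> i then energy K c p \<zeta> else 0)"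
  have Kp: "12 * (2 * real p + 1)^2 \<le> K"
  proof -
    have "(2 * real p + 1)^2 \<le> (2 * real M + 1)^2" using pM by (intro power_mono) auto
    then show ?thesis using K by linarith
  qed
  have K1: "1 \<le> K"
  proof -
    have "1 \<le> (2 * real M + 1)^2" by (simp add: one_le_power)
    then show ?thesis using K by linarith
  qed
  have \<rho>: "0 \<le> 1 - \<rho>"
  proof -
    have "1 * 1 \<le> real M * K" using M K1 by (intro mult_mono) auto
    then show ?thesis by (simp add: \<rho>_def)
  qed
  note closed = hop_closed_block[OF pM, of c]
  have step: "hop_mean M W \<zeta> \<le> (1 - \<rho>) * W \<zeta>" if \<zeta>: "\<zeta> \<in> block c p" for \<zeta>
  proof (cases "\<exists>i. 2 \<le> \<zeta> i")
    case True
    then obtain i where i: "2 \<le> \<zeta> i" by blast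
    obtain a b where blk: "block_on a b c p \<zeta>" using \<zeta> by (auto simp: block_def)
    have "hop_mean M W \<zeta> \<le> hop_mean M (energy K c p) \<zeta>"
      using block_energy_bounds(1)[OF _ Kp]
      by (intro hop_mean_le[OF closed \<zeta>]) (auto simp: W_def block_def)
    also have "\<dots> \<le> (1 - \<rho>) * energy K c p \<zeta>"
      unfolding \<rho>_def by (rule energy_contracts[OF blk pM Kp i])
    finally show ?thesis using True by (simp add: W_def)
  next
    case False
    then have "\<zeta> i \<le> 1" for i by (metis not_less_eq_eq numeral_2_eq_2 One_nat_def)
    then have "hop M r d \<zeta> = \<zeta>" for r d by (rule hop_stable)
    then show ?thesis using False by (simp add: W_def hop_mean_def)
  qed
  have W: "(hop_mean M ^^ n) W \<zeta> \<le> (1 - \<rho>) ^ n * W \<zeta>" if "\<zeta> \<in> block c p" for \<zeta>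
  proof (induction n)
    case (Suc n)
    have "(hop_mean M ^^ Suc n) W \<zeta> = (hop_mean M ^^ n) (hop_mean M W) \<zeta>"
      by (simp add: funpow_swap1)
    also have "\<dots> \<le> (hop_mean M ^^ n) (\<lambda>\<zeta>. (1 - \<rho>) * W \<zeta>) \<zeta>"
      by (rule hop_mean_power_le[OF closed that step])
    also have "\<dots> \<le> (1 - \<rho>) * ((1 - \<rho>) ^ n * W \<zeta>)"
      unfolding hop_mean_power_cmult using Suc \<rho> by (intro mult_left_mono)
    finally show ?case by simp
  qed simp
  obtain a b where blk: "block_on a b c p \<eta>" using \<eta> by (auto simp: block_def)
  have "(hop_mean M ^^ n) unstable \<eta> \<le> (hop_mean M ^^ n) (\<lambda>\<zeta>. (2 / K) * W \<zeta>) \<eta>"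
  proof (rule hop_mean_power_le[OF closed \<eta>])
    fix \<zeta> assume "\<zeta> \<in> block c p"
    then obtain a b where "block_on a b c p \<zeta>" by (auto simp: block_def)
    then show "unstable \<zeta> \<le> (2 / K) * W \<zeta>"
      using block_energy_bounds(2)[OF _ Kp] K1 by (auto simp: unstable_def W_def field_simps)
  qed
  also have "\<dots> = (2 / K) * (hop_mean M ^^ n) W \<eta>"
    by (rule fun_cong[OF hop_mean_power_cmult])
  also have "\<dots> \<le> (2 / K) * ((1 - \<rho>) ^ n * W \<eta>)"
    using K1 by (intro mult_left_mono W \<eta>) auto
  also have "\<dots> \<le> (2 / K) * ((1 - \<rho>) ^ n * (2 * K * real M))"
  proof -
    have "W \<eta> \<le> 2 * K * real p"
      using block_energy_bounds(4)[OF blk Kp] K1 by (auto simp: W_def)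
    also have "\<dots> \<le> 2 * K * real M" using pM K1 by (intro mult_left_mono) auto
    finally show ?thesis using K1 \<rho> by (intro mult_left_mono) auto
  qed
  also have "\<dots> = 4 * real M * (1 - \<rho>) ^ n" using K1 by simp
  finally show ?thesis by (simp add: \<rho>_def)
qed

section \<open>Growth and merging of several blocks\<close>

definition periodic :: "nat \<Rightarrow> (int \<Rightarrow> 'a) \<Rightarrow> bool" where
  "periodic M f \<longleftrightarrow> (\<forall>i. f (i + int M) = f i)"

lemma periodic_mult:
  assumes "periodic M f"
  shows "f (i + z * int M) = f i"
proof -
  have nat: "f (j + int n * int M) = f j" for n j
  proof (induction n)
    case (Suc n)
    have "f (j + int (Suc n) * int M) = f ((j + int n * int M) + int M)"
      by (simp add: algebra_simps)
    then show ?case using assms Suc by (simp add: periodic_def)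
  qed simp
  show ?thesis
  proof (cases "0 \<le> z")
    case True
    then show ?thesis using nat[of i "nat z"] by simp
  next
    case False
    then show ?thesis using nat[of "i + z * int M" "nat (- z)"] by (simp add: algebra_simps)
  qed
qed

lemma periodic_mod: "periodic M f \<Longrightarrow> f (i mod int M) = f i"
  using periodic_mult[of M f "i mod int M" "i div int M"]
  by (metis mod_mult_div_eq mult.commute)

lemma sum_period_shift:
  fixes f :: "int \<Rightarrow> 'a::comm_monoid_add"
  assumes "periodic M f" "0 < M"
  shows "(\<Sum>i\<in>{0..<int M}. f (i - d)) = (\<Sum>i\<in>{0..<int M}. f i)"
proof (rule sum.reindex_bij_witness[where i = "\<lambda>j. (j + d) mod int M" and j = "\<lambda>i. (i - d) mod int M"])
  fix i assume "i \<in> {0..<int M}"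
  then show "((i - d) mod int M + d) mod int M = i" "((i + d) mod int M - d) mod int M = i"
    by (simp_all add: mod_simps)
qed (use assms in \<open>auto simp: periodic_mod\<close>)

text \<open>
  All runs between the sites \<open>i\<close> and \<open>j\<close> are nonempty; nonempty runs
  stay nonempty, so this relation only grows in time.
\<close>
definition joined :: "(int \<Rightarrow> nat) \<Rightarrow> int \<Rightarrow> int \<Rightarrow> bool" where
  "joined \<eta> i j \<longleftrightarrow> (\<forall>l. min i j \<le> l \<and> l \<le> max i j \<longrightarrow> 0 < \<eta> l)"

lemma joined_trans:
  assumes "joined \<eta> i j" "joined \<eta> j k"
  shows "joined \<eta> i k"
  unfolding joined_def
proof (intro allI impI)
  fix l assume "min i k \<le> l \<and> l \<le> max i k"
  then have "(min i j \<le> l \<and> l \<le> max i j) \<or> (min j k \<le> l \<and> l \<le> max j k)"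
    by linarith
  then show "0 < \<eta> l" using assms unfolding joined_def by blast
qed

lemma joined_shift:
  assumes "periodic M \<eta>" "joined \<eta> i j"
  shows "joined \<eta> (i + z * int M) (j + z * int M)"
  unfolding joined_def
proof (intro allI impI)
  fix l assume "min (i + z * int M) (j + z * int M) \<le> l \<and> l \<le> max (i + z * int M) (j + z * int M)"
  then have "min i j \<le> l - z * int M \<and> l - z * int M \<le> max i j" by linarith
  then have "0 < \<eta> (l - z * int M)" using assms(2) unfolding joined_def by blast
  then show "0 < \<eta> l" using periodic_mult[OF assms(1), of "l - z * int M" z] by simp
qed

lemma joined_hop: "joined \<eta> i j \<Longrightarrow> joined (hop M r d \<eta>) i j"
  unfolding joined_def using hop_pos by blast

lemma joined_neighbour:
  assumes "0 < \<eta> i" "0 < \<eta> (i - d)" "d = 1 \<or> d = -1"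
  shows "joined \<eta> i (i - d)"
  unfolding joined_def
proof (intro allI impI)
  fix l assume "min i (i - d) \<le> l \<and> l \<le> max i (i - d)"
  then have "l = i \<or> l = i - d" using assms(3) by linarith
  then show "0 < \<eta> l" using assms by blast
qed

text \<open>
  The components of the support, taken modulo the period, are tracked by anchors: every
  component contains a translate of an anchor. Since new nonempty runs arise only next to old
  ones, the same anchors serve for all times, even if components grow and merge;
  \<open>card C\<close> bounds their number.
\<close>
definition anchored :: "nat \<Rightarrow> int set \<Rightarrow> (int \<Rightarrow> nat) set" where
  "anchored M C = {\<eta>. periodic M \<eta> \<and> M \<le> (\<Sum>i\<in>{0..<int M}. \<eta> i) \<and> (\<forall>c\<in>C. 0 < \<eta> c) \<and>
     (\<forall>i. 0 < \<eta> i \<longrightarrow> (\<exists>c\<in>C. \<exists>z. joined \<eta> i (c + z * int M)))}"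

lemma periodic_hop:
  assumes "periodic M \<eta>"
  shows "periodic M (hop M r d \<eta>)"
  unfolding periodic_def
proof
  fix i
  have "\<eta> (i + int M - d) = \<eta> (i - d)" "\<eta> (i + int M) = \<eta> i"
    using assms unfolding periodic_def by (metis add_diff_eq diff_add_eq add.commute)+
  moreover have "(i + int M - d) mod int M = (i - d) mod int M"
    by (metis add.commute add_diff_eq mod_add_self1)
  ultimately show "hop M r d \<eta> (i + int M) = hop M r d \<eta> i"
    by (simp add: hop_def)
qed

lemma sum_hop:
  assumes "periodic M \<eta>" "0 < M"
  shows "(\<Sum>i\<in>{0..<int M}. hop M r d \<eta> i) = (\<Sum>i\<in>{0..<int M}. \<eta> i)"
proof -
  define A where "A = (\<lambda>i. if i mod int M = r \<and> 2 \<le> \<eta> i then 1 else (0::int))"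
  have "periodic M A"
    using assms unfolding periodic_def A_def by simp
  then have A: "(\<Sum>i\<in>{0..<int M}. A (i - d)) = (\<Sum>i\<in>{0..<int M}. A i)"
    using assms(2) by (rule sum_period_shift)
  have "int (hop M r d \<eta> i) = int (\<eta> i) - A i + A (i - d)" for i
    by (auto simp: hop_def A_def)
  then have "int (\<Sum>i\<in>{0..<int M}. hop M r d \<eta> i) = int (\<Sum>i\<in>{0..<int M}. \<eta> i)"
    using A by (simp add: sum.distrib sum_subtractf)
  then show ?thesis by (simp only: of_nat_eq_iff)
qed

lemma hop_closed_anchored:
  assumes "0 < M"
  shows "hop_closed M (anchored M C)"
proof -
  have "hop M r d \<eta> \<in> anchored M C"
    if \<eta>: "\<eta> \<in> anchored M C" and d: "d = 1 \<or> d = -1" for \<eta> r d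
  proof -
    have per: "periodic M \<eta>" and C: "\<And>c. c \<in> C \<Longrightarrow> 0 < \<eta> c"
      and an: "\<And>i. 0 < \<eta> i \<Longrightarrow> \<exists>c\<in>C. \<exists>z. joined \<eta> i (c + z * int M)"
      using \<eta> by (auto simp: anchored_def)
    let ?h = "hop M r d \<eta>"
    have "\<exists>c\<in>C. \<exists>z. joined ?h i (c + z * int M)" if i: "0 < ?h i" for i
    proof (cases "0 < \<eta> i")
      case True
      then show ?thesis using an joined_hop by blast
    next
      case False
      then have "0 < \<eta> (i - d)" using i by (auto simp: hop_def split: if_splits)
      then obtain c z where c: "c \<in> C" "joined ?h (i - d) (c + z * int M)"
        using an joined_hop by blast
      have "joined ?h i (i - d)"
        by (intro joined_neighbour hop_pos i d \<open>0 < \<eta> (i - d)\<close>)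
      then show ?thesis using c joined_trans by blast
    qed
    then show ?thesis
      using \<eta> periodic_hop[OF per, of r d] sum_hop[OF per assms, of r d] C hop_pos
      unfolding anchored_def mem_Collect_eq by metis
  qed
  then show ?thesis unfolding hop_closed_def by blast
qed

lemma component_interval:
  assumes per: "periodic M \<eta>" and gap: "\<eta> z0 = 0" and c: "0 < \<eta> c" and M: "0 < M"
  obtains a b where "a \<le> c" "c < b" "b - a < int M" "\<And>i. joined \<eta> i c \<longleftrightarrow> a \<le> i \<and> i < b"
proof -
  let ?L = "{z\<in>{c - int M..<c}. \<eta> z = 0}" and ?R = "{z\<in>{c<..c + int M}. \<eta> z = 0}"
  have fin: "finite ?L" "finite ?R"
    by (rule finite_subset[of _ "{c - int M..<c}"]; auto) (rule finite_subset[of _ "{c<..c + int M}"]; auto)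
  have shift: "\<eta> (z + int M) = \<eta> z" "\<eta> (z - int M) = \<eta> z" for z
    using per unfolding periodic_def by (metis, metis diff_add_cancel)
  \<comment> \<open>A translate of the empty run within one period to the left of the anchor.\<close>
  define y where "y = c - int M + (z0 - c) mod int M"
  have "y = z0 + (- 1 - (z0 - c) div int M) * int M"
    unfolding y_def using div_mult_mod_eq[of "z0 - c" "int M"] by (simp add: algebra_simps)
  then have y0: "\<eta> y = 0" using periodic_mult[OF per] gap by metis
  have "c - int M \<le> y" "y < c" using M by (simp_all add: y_def)
  then have L: "?L \<noteq> {}" using y0 by auto
  have Rmem: "z + int M \<in> ?R" if "z \<in> ?L" for z
  proof -
    have "\<eta> (z + int M) = 0" using that shift by simp
    then have "z + int M \<noteq> c" using c by auto
    then show ?thesis using that \<open>\<eta> (z + int M) = 0\<close> by auto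
  qed
  then have R: "?R \<noteq> {}" using L by blast
  define a b where "a = Max ?L + 1" and "b = Min ?R"
  have a: "a - 1 \<in> ?L" and b: "b \<in> ?R"
    using Max_in[OF fin(1) L] Min_in[OF fin(2) R] by (simp_all add: a_def b_def)
  have "b \<le> a - 1 + int M"
    unfolding b_def by (rule Min_le[OF fin(2) Rmem[OF a]])
  moreover have "joined \<eta> i c \<longleftrightarrow> a \<le> i \<and> i < b" for i
  proof
    assume j: "joined \<eta> i c"
    have "\<not> i < a"
    proof
      assume "i < a"
      then have "min i c \<le> a - 1 \<and> a - 1 \<le> max i c" using a by auto
      then have "0 < \<eta> (a - 1)" using j unfolding joined_def by blast
      then show False using a by simp
    qed
    moreover have "\<not> b \<le> i"
    proof
      assume "b \<le> i"
      then have "min i c \<le> b \<and> b \<le> max i c" using b by auto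
      then have "0 < \<eta> b" using j unfolding joined_def by blast
      then show False using b by simp
    qed
    ultimately show "a \<le> i \<and> i < b" by simp
  next
    assume i: "a \<le> i \<and> i < b"
    have "0 < \<eta> l" if l: "a \<le> l" "l < b" for l
    proof (rule ccontr)
      assume "\<not> 0 < \<eta> l"
      then have l0: "\<eta> l = 0" by simp
      then consider "l < c" | "c < l" using c by force
      then show False
      proof cases
        case 1
        then have "l \<in> ?L" using l l0 a by auto
        then have "l \<le> a - 1" using Max_ge[OF fin(1)] by (simp add: a_def)
        then show False using l by simp
      next
        case 2
        then have "l \<in> ?R" using l l0 b by auto
        then have "b \<le> l" using Min_le[OF fin(2)] by (simp add: b_def)
        then show False using l by simp
      qed
    qed
    then show "joined \<eta> i c"
      unfolding joined_def using i a b by (auto simp: min_def max_def split: if_splits)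
  qed
  ultimately show ?thesis using that[of a b] a b by auto
qed

text \<open>Removing superfluous particles one at a time, never emptying a site.\<close>
lemma exists_trimmed:
  fixes f :: "'a \<Rightarrow> nat"
  assumes "finite A" "\<And>i. i \<in> A \<Longrightarrow> 0 < f i" "card A \<le> q" "q \<le> sum f A"
  shows "\<exists>g. (\<forall>i\<in>A. 0 < g i \<and> g i \<le> f i) \<and> sum g A = q"
  using assms(2,4)
proof (induction "sum f A - q" arbitrary: f)
  case 0
  then show ?case by (intro exI[of _ f]) auto
next
  case (Suc n)
  have "\<exists>j\<in>A. 2 \<le> f j"
  proof (rule ccontr)
    assume "\<not> ?thesis"
    then have "sum f A \<le> (\<Sum>i\<in>A. 1)" by (intro sum_mono) force
    then show False using Suc.hyps(2) assms(3) by simp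
  qed
  then obtain j where j: "j \<in> A" "2 \<le> f j" by blast
  define h where "h = f(j := f j - 1)"
  have "sum f A = f j + sum f (A - {j})" "sum h A = h j + sum h (A - {j})"
    using assms(1) j(1) by (simp_all add: sum.remove)
  moreover have "sum h (A - {j}) = sum f (A - {j})"
    by (intro sum.cong) (auto simp: h_def)
  ultimately have h: "sum f A = sum h A + 1" using j by (simp add: h_def)
  have "\<exists>g. (\<forall>i\<in>A. 0 < g i \<and> g i \<le> h i) \<and> sum g A = q"
    by (rule Suc.hyps(1)) (use Suc h j in \<open>auto simp: h_def\<close>)
  then obtain g where g: "\<forall>i\<in>A. 0 < g i \<and> g i \<le> h i" "sum g A = q" by blast
  have "h i \<le> f i" for i by (simp add: h_def)
  then have "\<forall>i\<in>A. 0 < g i \<and> g i \<le> f i" using g(1) order_trans by blast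
  then show ?case using g(2) by blast
qed

text \<open>
  The mass is capped at \<open>M\<close>: a block of \<open>M\<close> particles already fills a
  whole period, whereas a larger one could run into its own translates.
\<close>
definition component_mass :: "nat \<Rightarrow> (int \<Rightarrow> nat) \<Rightarrow> int \<Rightarrow> nat" where
  "component_mass M \<eta> c = min M (\<Sum>i\<in>{i. joined \<eta> i c}. \<eta> i)"

lemma exists_block_below:
  assumes per: "periodic M \<eta>" and gap: "\<eta> z0 = 0" and c: "0 < \<eta> c" and M: "0 < M"
  obtains \<zeta> where "\<zeta> \<le> \<eta>" "\<zeta> \<in> block c (component_mass M \<eta> c)"
proof -
  obtain a b where ab: "a \<le> c" "c < b" "b - a < int M" "\<And>i. joined \<eta> i c \<longleftrightarrow> a \<le> i \<and> i < b"
    using component_interval[OF assms] by metis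
  have pos: "0 < \<eta> i" if "i \<in> {a..<b}" for i
    using ab(4)[of i] that unfolding joined_def by auto
  have eq: "{i. joined \<eta> i c} = {a..<b}" unfolding ab(4) by auto
  define p where "p = component_mass M \<eta> c"
  have p: "p = min M (sum \<eta> {a..<b})" by (simp add: p_def component_mass_def eq)
  have "card {a..<b} \<le> sum \<eta> {a..<b}" using pos by (intro card_le_sum_nat) auto
  then have "card {a..<b} \<le> p" using ab(3) by (simp add: p)
  moreover have "p \<le> sum \<eta> {a..<b}" by (simp add: p)
  ultimately have "\<exists>g. (\<forall>i\<in>{a..<b}. 0 < g i \<and> g i \<le> \<eta> i) \<and> sum g {a..<b} = p"
    using pos by (intro exists_trimmed) auto
  then obtain g where g: "\<And>i. i \<in> {a..<b} \<Longrightarrow> 0 < g i \<and> g i \<le> \<eta> i" "sum g {a..<b} = p"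
    by blast
  define \<zeta> where "\<zeta> = (\<lambda>i. if i \<in> {a..<b} then g i else 0)"
  have "\<zeta> \<le> \<eta>" using g by (auto simp: \<zeta>_def le_fun_def)
  moreover have "block_on a b c p \<zeta>"
    unfolding block_on_def
  proof (intro conjI ab allI)
    fix i show "0 < \<zeta> i \<longleftrightarrow> a \<le> i \<and> i < b" using g(1)[of i] by (simp add: \<zeta>_def)
  next
    have "sum \<zeta> {a..<b} = sum g {a..<b}" by (intro sum.cong) (auto simp: \<zeta>_def)
    then show "sum \<zeta> {a..<b} = p" using g by simp
  qed
  ultimately show ?thesis using that[of \<zeta>] by (auto simp: block_def p_def)
qed

text \<open>
  The indicator that no interval of at least \<open>p\<close> nonempty runs contains
  \<open>c\<close>. In contrast to instability, this event is monotone, so its probability can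
  be bounded for a smaller initial sequence.
\<close>
definition short :: "int \<Rightarrow> nat \<Rightarrow> (int \<Rightarrow> nat) \<Rightarrow> real" where
  "short c p \<eta> =
     (if \<exists>a b. a \<le> c \<and> c < b \<and> int p \<le> b - a \<and> (\<forall>i\<in>{a..<b}. 0 < \<eta> i) then 0 else 1)"

lemma short_antimono:
  assumes "\<eta> \<le> \<zeta>"
  shows "short c p \<zeta> \<le> short c p \<eta>"
proof -
  have "0 < \<zeta> i" if "0 < \<eta> i" for i
    using that le_funD[OF assms, of i] by linarith
  then have "\<exists>a b. a \<le> c \<and> c < b \<and> int p \<le> b - a \<and> (\<forall>i\<in>{a..<b}. 0 < \<zeta> i)"
    if "\<exists>a b. a \<le> c \<and> c < b \<and> int p \<le> b - a \<and> (\<forall>i\<in>{a..<b}. 0 < \<eta> i)"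
    using that by blast
  then show ?thesis unfolding short_def by (smt (verit))
qed

lemma short_le_unstable:
  assumes "\<eta> \<in> block c p"
  shows "short c p \<eta> \<le> unstable \<eta>"
proof (cases "\<exists>i. 2 \<le> \<eta> i")
  case True
  then show ?thesis by (simp add: unstable_def short_def)
next
  case False
  obtain a b where blk: "block_on a b c p \<eta>" using assms by (auto simp: block_def)
  have pos: "0 < \<eta> i" if "i \<in> {a..<b}" for i
    using block_on_pos_iff[OF blk, of i] that by simp
  have "\<eta> i = 1" if "i \<in> {a..<b}" for i
    using pos[OF that] False by (metis One_nat_def Suc_leI le_antisym not_less_eq_eq numeral_2_eq_2)
  then have "sum \<eta> {a..<b} = (\<Sum>i\<in>{a..<b}. 1)" by (intro sum.cong) auto
  moreover have ab: "a \<le> c" "c < b" "sum \<eta> {a..<b} = p"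
    using blk by (simp_all add: block_on_def)
  ultimately have "int p \<le> b - a" by simp
  then have "\<exists>a b. a \<le> c \<and> c < b \<and> int p \<le> b - a \<and> (\<forall>i\<in>{a..<b}. 0 < \<eta> i)"
    using ab pos by blast
  then have "short c p \<eta> = 0" by (simp only: short_def if_True)
  then show ?thesis by (simp add: unstable_def)
qed

definition has_gap :: "(int \<Rightarrow> nat) \<Rightarrow> real" where
  "has_gap \<eta> = (if \<exists>i. \<eta> i = 0 then 1 else 0)"

lemma has_gap_antimono: "\<eta> \<le> \<zeta> \<Longrightarrow> has_gap \<zeta> \<le> has_gap \<eta>"
  by (auto simp: has_gap_def le_fun_def) (metis le_zero_eq)

lemma hop_mean_power_full:
  assumes "\<And>i. 0 < \<eta> i" "0 < M"
  shows "(hop_mean M ^^ n) has_gap \<eta> = 0"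
proof -
  have closed: "hop_closed M {\<eta>. \<forall>i. 0 < \<eta> i}"
    unfolding hop_closed_def by (simp add: hop_pos)
  have \<eta>: "\<eta> \<in> {\<eta>. \<forall>i. 0 < \<eta> i}" using assms by simp
  have "(hop_mean M ^^ n) has_gap \<eta> \<le> (hop_mean M ^^ n) (\<lambda>_. 0) \<eta>"
    by (rule hop_mean_power_le[OF closed \<eta>]) (simp add: has_gap_def)
  moreover have "(hop_mean M ^^ n) (\<lambda>_. 0) \<eta> \<le> (hop_mean M ^^ n) has_gap \<eta>"
    by (rule hop_mean_power_le[OF closed \<eta>]) (simp add: has_gap_def)
  ultimately show ?thesis using assms(2) by (simp add: hop_mean_power_const)
qed

lemma short_zeroE:
  assumes "short c p \<eta> = 0"
  obtains a b where "a \<le> c" "c < b" "int p \<le> b - a" "\<And>i. a \<le> i \<Longrightarrow> i < b \<Longrightarrow> 0 < \<eta> i"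
proof -
  have "\<exists>a b. a \<le> c \<and> c < b \<and> int p \<le> b - a \<and> (\<forall>i\<in>{a..<b}. 0 < \<eta> i)"
    using assms unfolding short_def by (metis zero_neq_one)
  then show ?thesis using that by auto
qed

lemma periodic_full:
  assumes "periodic M \<eta>" "int M \<le> b - a" "0 < M" "\<And>i. a \<le> i \<Longrightarrow> i < b \<Longrightarrow> 0 < \<eta> i"
  shows "0 < \<eta> i"
proof -
  define j where "j = a + (i - a) mod int M"
  have "j = i + (- ((i - a) div int M)) * int M"
    unfolding j_def using div_mult_mod_eq[of "i - a" "int M"] by (simp add: algebra_simps)
  then have "\<eta> j = \<eta> i" using periodic_mult[OF assms(1)] by metis
  moreover have "0 < \<eta> j"
  proof (rule assms(4))
    show "a \<le> j" using assms(3) by (simp add: j_def)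
    have "(i - a) mod int M < int M" using assms(3) by simp
    then show "j < b" using assms(2) by (simp add: j_def)
  qed
  ultimately show ?thesis by simp
qed

text \<open>
  Every nonempty run of one period has a translate in the component of some anchor.
\<close>
lemma sum_le_component_masses:
  assumes \<eta>: "\<eta> \<in> anchored M C" and "finite C" and gap: "\<eta> z0 = 0" and M: "0 < M"
    and small: "\<And>c. c \<in> C \<Longrightarrow> component_mass M \<eta> c < M"
  shows "M \<le> (\<Sum>c\<in>C. component_mass M \<eta> c)"
proof -
  have per: "periodic M \<eta>" and sum: "M \<le> (\<Sum>i\<in>{0..<int M}. \<eta> i)"
    and pos: "\<And>c. c \<in> C \<Longrightarrow> 0 < \<eta> c"
    and an: "\<And>i. 0 < \<eta> i \<Longrightarrow> \<exists>c\<in>C. \<exists>z. joined \<eta> i (c + z * int M)"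
    using \<eta> by (auto simp: anchored_def)
  let ?K = "\<lambda>c. {i. joined \<eta> i c}"
  have fin: "finite (?K c)" if cC: "c \<in> C" for c
  proof -
    obtain a b where "\<And>i. joined \<eta> i c \<longleftrightarrow> a \<le> i \<and> i < b"
      using component_interval[OF per gap pos[OF cC] M] by metis
    then have "?K c = {a..<b}" by (simp add: set_eq_iff)
    then show ?thesis by simp
  qed
  let ?P = "{i\<in>{0..<int M}. 0 < \<eta> i}"
  have "(\<Sum>i\<in>{0..<int M}. \<eta> i) = (\<Sum>i\<in>?P. \<eta> i)"
    by (intro sum.mono_neutral_right) auto
  also have "\<dots> \<le> (\<Sum>(c, i)\<in>Sigma C ?K. \<eta> i)"
  proof (rule sum_le_included[where i = "\<lambda>(c, i). i mod int M"])
    show "finite (Sigma C ?K)" using assms(2) fin by auto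
    show "finite ?P" by (rule finite_subset[of _ "{0..<int M}"]) auto
    show "\<forall>i\<in>?P. \<exists>y\<in>Sigma C ?K. (case y of (c, i) \<Rightarrow> i mod int M) = i
            \<and> \<eta> i \<le> (case y of (c, i) \<Rightarrow> \<eta> i)"
    proof
      fix i assume i: "i \<in> ?P"
      then obtain c z where c: "c \<in> C" "joined \<eta> i (c + z * int M)" using an by blast
      define j where "j = i + (- z) * int M"
      have "joined \<eta> j c"
        using joined_shift[OF per c(2), of "- z"] by (simp add: j_def)
      moreover have "j mod int M = i" using i unfolding j_def by (simp only: mod_mult_self1) simp
      moreover have "\<eta> j = \<eta> i" unfolding j_def by (rule periodic_mult[OF per])
      ultimately show "\<exists>y\<in>Sigma C ?K. (case y of (c, i) \<Rightarrow> i mod int M) = i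
            \<and> \<eta> i \<le> (case y of (c, i) \<Rightarrow> \<eta> i)"
        using c by (intro bexI[of _ "(c, j)"]) auto
    qed
  qed auto
  also have "\<dots> = (\<Sum>c\<in>C. \<Sum>i\<in>?K c. \<eta> i)"
    using assms(2) fin by (subst sum.Sigma) auto
  also have "\<dots> = (\<Sum>c\<in>C. component_mass M \<eta> c)"
  proof (rule sum.cong)
    fix c assume "c \<in> C"
    then have "component_mass M \<eta> c < M" by (rule small)
    then show "(\<Sum>i\<in>?K c. \<eta> i) = component_mass M \<eta> c"
      unfolding component_mass_def by linarith
  qed simp
  finally show ?thesis using sum by linarith
qed


lemma joined_within:
  assumes "a \<le> i" "i < b" "a \<le> j" "j < b" "\<forall>l. a \<le> l \<and> l < b \<longrightarrow> 0 < \<eta> l"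
  shows "joined \<eta> i j"
  unfolding joined_def
proof (intro allI impI)
  fix l assume "min i j \<le> l \<and> l \<le> max i j"
  then have "a \<le> l \<and> l < b" using assms(1-4) by linarith
  then show "0 < \<eta> l" using assms(5) by blast
qed

text \<open>
  The dichotomy behind the stages. If one of the intervals around the anchors has length
  \<open>M\<close> or more, it fills the period. Otherwise, no two anchors being joined up to
  periods, the intervals are pairwise disjoint modulo \<open>M\<close>; their total length is at
  least the total mass, hence at least \<open>M\<close>, and they cover all residues.
\<close>
lemma unjoined_blocks_fill:
  assumes \<eta>: "\<eta> \<in> anchored M C" and \<zeta>: "periodic M \<zeta>" and "finite C" and gap: "\<eta> z0 = 0" and M: "0 < M"
    and long: "\<And>c. c \<in> C \<Longrightarrow> short c (component_mass M \<eta> c) \<zeta> = 0"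
    and apart: "\<And>c c' z. c \<in> C \<Longrightarrow> c' \<in> C \<Longrightarrow> joined \<zeta> c (c' + z * int M) \<Longrightarrow> c = c'"
  shows "0 < \<zeta> i"
proof -
  have "\<exists>a b. a \<le> c \<and> c < b \<and> int (component_mass M \<eta> c) \<le> b - a \<and> (\<forall>i. a \<le> i \<and> i < b \<longrightarrow> 0 < \<zeta> i)"
    if "c \<in> C" for c
    using short_zeroE[OF long[OF that]] by metis
  then obtain a b where ab: "\<And>c. c \<in> C \<Longrightarrow> a c \<le> c \<and> c < b c
      \<and> int (component_mass M \<eta> c) \<le> b c - a c \<and> (\<forall>i. a c \<le> i \<and> i < b c \<longrightarrow> 0 < \<zeta> i)"
    by metis
  show ?thesis
  proof (cases "\<exists>c\<in>C. int M \<le> b c - a c")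
    case True
    then obtain c where "c \<in> C" "int M \<le> b c - a c" by blast
    then show ?thesis using periodic_full[OF \<zeta> _ M, of "b c" "a c"] ab by blast
  next
    case False
    then have lt: "b c - a c < int M" if "c \<in> C" for c using that by force
    define T where "T = Sigma C (\<lambda>c. {a c..<b c})"
    have finT: "finite T" using assms(3) by (auto simp: T_def)
    have inj: "inj_on (\<lambda>(c, i). i mod int M) T"
    proof (rule inj_onI, clarify)
      fix c i c' i' assume ci: "(c, i) \<in> T" "(c', i') \<in> T" and eq: "i mod int M = i' mod int M"
      have c: "c \<in> C" "a c \<le> i" "i < b c" "c' \<in> C" "a c' \<le> i'" "i' < b c'"
        using ci by (auto simp: T_def)
      obtain z where z: "i = i' + z * int M"
        using eq by (metis mod_eqE mult.commute)
      have 1: "joined \<zeta> c i" and 2: "joined \<zeta> i' c'"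
        using ab[OF c(1)] ab[OF c(4)] c joined_within[of "a c" c "b c" i] joined_within[of "a c'" i' "b c'" c']
        by blast+
      have "joined \<zeta> i (c' + z * int M)"
        using joined_shift[OF \<zeta> 2, of z] by (simp add: z)
      then have "c = c'" using apart[OF c(1,4)] joined_trans[OF 1] by blast
      moreover have "i = i'"
      proof -
        have "int M dvd i - i'" using eq by (simp add: mod_eq_dvd_iff)
        moreover have "\<bar>i - i'\<bar> < int M" using c lt[OF c(1)] \<open>c = c'\<close> by auto
        ultimately show ?thesis
          using zdvd_not_zless[of "\<bar>i - i'\<bar>" "int M"] by (cases "i = i'") auto
      qed
      ultimately show "c = c' \<and> i = i'" by simp
    qed
    have sub: "(\<lambda>(c, i). i mod int M) ` T \<subseteq> {0..<int M}" using M by auto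
    have "M \<le> (\<Sum>c\<in>C. component_mass M \<eta> c)"
      using ab lt by (intro sum_le_component_masses[OF \<eta> assms(3) gap M]) force
    also have "\<dots> \<le> (\<Sum>c\<in>C. card {a c..<b c})"
      using ab by (intro sum_mono) force
    also have "\<dots> = card T" using assms(3) by (simp add: T_def)
    also have "\<dots> = card ((\<lambda>(c, i). i mod int M) ` T)"
      by (rule card_image[OF inj, symmetric])
    finally have "(\<lambda>(c, i). i mod int M) ` T = {0..<int M}"
      using sub by (intro card_seteq) auto
    moreover have "i mod int M \<in> {0..<int M}" using M by simp
    ultimately obtain c j where cj: "(c, j) \<in> T" "j mod int M = i mod int M"
      by (metis (no_types, lifting) case_prod_conv imageE old.prod.exhaust)
    then have "c \<in> C" "a c \<le> j \<and> j < b c" by (simp_all add: T_def)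
    then have "0 < \<zeta> j" using ab by blast
    moreover have "\<zeta> j = \<zeta> i" using cj(2) periodic_mod[OF \<zeta>] by metis
    ultimately show ?thesis by simp
  qed
qed

text \<open>
  Monotonicity reduces the claim to the trimmed component of \<open>c\<close> on its own, which
  has length \<open>p\<close> once it is stable.
\<close>
lemma short_probability:
  assumes \<eta>: "\<eta> \<in> anchored M C" and gap: "\<eta> z0 = 0" and M: "0 < M" and c: "c \<in> C"
    and K: "12 * (2 * real M + 1)^2 \<le> K"
  shows "(hop_mean M ^^ n) (short c (component_mass M \<eta> c)) \<eta> \<le> 4 * real M * (1 - 1 / (real M * K)) ^ n"
proof -
  let ?p = "component_mass M \<eta> c"
  have pM: "?p \<le> M" by (simp add: component_mass_def)
  have "periodic M \<eta>" "0 < \<eta> c" using \<eta> c by (auto simp: anchored_def)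
  then obtain \<zeta> where \<zeta>: "\<zeta> \<le> \<eta>" "\<zeta> \<in> block c ?p"
    using exists_block_below[of M \<eta> z0 c] gap M by blast
  have "(hop_mean M ^^ n) (short c ?p) \<eta> \<le> (hop_mean M ^^ n) (short c ?p) \<zeta>"
    by (rule hop_mean_power_antimono[OF short_antimono \<zeta>(1)])
  also have "\<dots> \<le> (hop_mean M ^^ n) unstable \<zeta>"
    by (rule hop_mean_power_le[OF hop_closed_block[OF pM] \<zeta>(2) short_le_unstable])
  also have "\<dots> \<le> 4 * real M * (1 - 1 / (real M * K)) ^ n"
    by (rule block_unstable_bound[OF \<zeta>(2) pM M K])
  finally show ?thesis .
qed

lemma anchored_remove:
  assumes \<zeta>: "\<zeta> \<in> anchored M C" and c: "c \<in> C" "c' \<in> C" "c \<noteq> c'" "joined \<zeta> c (c' + z * int M)"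
  shows "\<zeta> \<in> anchored M (C - {c})"
proof -
  have per: "periodic M \<zeta>" using \<zeta> by (simp add: anchored_def)
  have "\<exists>b\<in>C - {c}. \<exists>z. joined \<zeta> i (b + z * int M)" if "0 < \<zeta> i" for i
  proof -
    obtain b y where b: "b \<in> C" "joined \<zeta> i (b + y * int M)"
    proof -
      have "\<forall>i. 0 < \<zeta> i \<longrightarrow> (\<exists>c\<in>C. \<exists>z. joined \<zeta> i (c + z * int M))"
        using \<zeta> by (simp add: anchored_def)
      then show ?thesis using that \<open>0 < \<zeta> i\<close> by blast
    qed
    show ?thesis
    proof (cases "b = c")
      case False
      then show ?thesis using b by blast
    next
      case True
      have "joined \<zeta> (c + y * int M) (c' + z * int M + y * int M)"
        by (rule joined_shift[OF per c(4)])
      then have "joined \<zeta> i (c' + (z + y) * int M)"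
        using joined_trans[OF b(2)[unfolded True]] by (simp add: algebra_simps)
      then show ?thesis using c by blast
    qed
  qed
  then show ?thesis using \<zeta> by (simp add: anchored_def)
qed

lemma hop_mean_power_has_gap_le_1:
  assumes "0 < M"
  shows "(hop_mean M ^^ n) has_gap \<eta> \<le> 1"
proof -
  have "(hop_mean M ^^ n) has_gap \<eta> \<le> (hop_mean M ^^ n) (\<lambda>_. 1) \<eta>"
    by (rule hop_mean_power_le[of M UNIV]) (auto simp: hop_closed_def has_gap_def)
  then show ?thesis using assms by (simp add: hop_mean_power_const)
qed

text \<open>
  Induction on the number of anchors, one stage of \<open>n\<close> steps for each. After a
  stage, some component has failed to grow to its mass (each has small probability), or two
  anchors have been joined and one of them can be dropped, or there is no empty run left.
\<close>
lemma gap_bound_stages: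
  assumes M: "0 < M" and K: "12 * (2 * real M + 1)^2 \<le> K" and "finite C" and "\<eta> \<in> anchored M C"
  shows "(hop_mean M ^^ (n * card C)) has_gap \<eta>
    \<le> real (card C)^2 * (4 * real M * (1 - 1 / (real M * K)) ^ n)"
  using assms(3,4)
proof (induction "card C" arbitrary: C \<eta>)
  case 0
  then have "C = {}" by simp
  then have "\<eta> i = 0" for i using 0 by (auto simp: anchored_def)
  then have "\<not> M \<le> (\<Sum>i\<in>{0..<int M}. \<eta> i)" using M by simp
  then show ?case using 0 by (simp add: anchored_def)
next
  case (Suc m)
  define e where "e = 4 * real M * (1 - 1 / (real M * K)) ^ n"
  have K1: "1 \<le> K"
  proof -
    have "1 \<le> (2 * real M + 1)^2" by (simp add: one_le_power)
    then show ?thesis using K by linarith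
  qed
  have e: "0 \<le> e"
  proof -
    have "1 * 1 \<le> real M * K" using M K1 by (intro mult_mono) auto
    then show ?thesis by (simp add: e_def)
  qed
  show ?case
  proof (cases "\<exists>z. \<eta> z = 0")
    case False
    then have "0 < \<eta> i" for i by (metis gr0I)
    then show ?thesis using hop_mean_power_full[OF _ M] e by (simp add: e_def)
  next
    case True
    then obtain z0 where gap: "\<eta> z0 = 0" by blast
    define s where "s = (\<lambda>c. short c (component_mass M \<eta> c))"
    note closed = hop_closed_anchored[OF M, of C]
    have s0: "0 \<le> s c \<zeta>" for c \<zeta> by (simp add: s_def short_def)
    have pointwise: "(hop_mean M ^^ (n * m)) has_gap \<zeta> \<le> (\<Sum>c\<in>C. s c \<zeta>) + real m^2 * e"
      if \<zeta>: "\<zeta> \<in> anchored M C" for \<zeta>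
    proof -
      have sum0: "0 \<le> (\<Sum>c\<in>C. s c \<zeta>)" using s0 by (intro sum_nonneg)
      consider (short) c where "c \<in> C" "s c \<zeta> \<noteq> 0"
        | (joined) c c' z where "c \<in> C" "c' \<in> C" "c \<noteq> c'" "joined \<zeta> c (c' + z * int M)"
        | (full) "\<And>c. c \<in> C \<Longrightarrow> s c \<zeta> = 0"
            "\<And>c c' z. c \<in> C \<Longrightarrow> c' \<in> C \<Longrightarrow> joined \<zeta> c (c' + z * int M) \<Longrightarrow> c = c'"
        by blast
      then show ?thesis
      proof cases
        case short
        then have "s c \<zeta> = 1" by (auto simp: s_def short_def split: if_splits)
        moreover have "s c \<zeta> \<le> (\<Sum>c\<in>C. s c \<zeta>)"
          using s0 short Suc.prems(1) by (intro member_le_sum) auto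
        moreover have "0 \<le> real m^2 * e" using e by simp
        ultimately show ?thesis
          using hop_mean_power_has_gap_le_1[OF M, of "n * m" \<zeta>] by linarith
      next
        case joined
        have m: "m = card (C - {c})" using Suc.hyps(2) joined(1) Suc.prems(1) by simp
        then have "(hop_mean M ^^ (n * m)) has_gap \<zeta> \<le> real m^2 * e"
          using Suc.hyps(1)[OF m _ anchored_remove[OF \<zeta> joined]] Suc.prems(1) by (simp add: e_def)
        then show ?thesis using sum0 by linarith
      next
        case full
        have "periodic M \<zeta>" using \<zeta> by (simp add: anchored_def)
        then have "0 < \<zeta> i" for i
          using unjoined_blocks_fill[OF Suc.prems(2) _ Suc.prems(1) gap M] full unfolding s_def by blast
        then have "(hop_mean M ^^ (n * m)) has_gap \<zeta> = 0"
          using hop_mean_power_full[OF _ M] by blast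
        moreover have "0 \<le> real m^2 * e" using e by simp
        ultimately show ?thesis using sum0 by linarith
      qed
    qed
    have "(hop_mean M ^^ (n * card C)) has_gap \<eta>
        = (hop_mean M ^^ n) ((hop_mean M ^^ (n * m)) has_gap) \<eta>"
      unfolding Suc.hyps(2)[symmetric] by (simp add: funpow_add)
    also have "\<dots> \<le> (hop_mean M ^^ n) (\<lambda>\<zeta>. (\<Sum>c\<in>C. s c \<zeta>) + real m^2 * e) \<eta>"
      by (rule hop_mean_power_le[OF closed Suc.prems(2) pointwise])
    also have "\<dots> = (\<Sum>c\<in>C. (hop_mean M ^^ n) (s c) \<eta>) + real m^2 * e"
      using M Suc.prems(1)
      by (simp only: hop_mean_power_add hop_mean_power_const hop_mean_power_sum)
    also have "\<dots> \<le> (\<Sum>c\<in>C. e) + real m^2 * e"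
      unfolding s_def e_def
      by (intro add_right_mono sum_mono short_probability[OF Suc.prems(2) gap M _ K])
    also have "\<dots> = (real (Suc m) + real m^2) * e"
      using Suc.hyps(2) by (simp add: algebra_simps)
    also have "\<dots> \<le> real (card C)^2 * e"
    proof (rule mult_right_mono[OF _ e])
      show "real (Suc m) + real m^2 \<le> real (card C)^2"
        unfolding Suc.hyps(2)[symmetric] by (simp add: power2_eq_square algebra_simps)
    qed
    finally show ?thesis by (simp add: e_def)
  qed
qed

section \<open>Configurations on the circle as periodic sequences of holes\<close>

text \<open>
  The holes of a configuration, unrolled to the integers and enumerated in increasing order. The
  enumeration fixes which hole has index 0, a choice that the configuration alone does not
  determine but that can be followed along the moves.
\<close>
definition hole_map :: "nat \<Rightarrow> nat \<Rightarrow> (int \<Rightarrow> int) \<Rightarrow> bool" where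
  "hole_map N M x \<longleftrightarrow> (\<forall>i. x i < x (i + 1)) \<and> (\<forall>i. x (i + int M) = x i + int N)"

definition config_of :: "nat \<Rightarrow> (int \<Rightarrow> int) \<Rightarrow> config" where
  "config_of N x = (\<lambda>z. if z \<in> torus N then if z \<in> range x then 0 else 1 else undefined)"

definition gaps :: "(int \<Rightarrow> int) \<Rightarrow> int \<Rightarrow> nat" where
  "gaps x i = nat (x (i + 1) - x i - 1)"

text \<open>
  A particle of run \<open>r\<close> that jumps to the right moves the hole with index
  \<open>r + 1\<close> one step to the left, and symmetrically for \<open>push_left\<close>.
\<close>
definition push_right :: "nat \<Rightarrow> int \<Rightarrow> (int \<Rightarrow> int) \<Rightarrow> int \<Rightarrow> int" where
  "push_right M r x i = x i - (if (i - 1) mod int M = r \<and> 2 \<le> gaps x (i - 1) then 1 else 0)"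

definition push_left :: "nat \<Rightarrow> int \<Rightarrow> (int \<Rightarrow> int) \<Rightarrow> int \<Rightarrow> int" where
  "push_left M r x i = x i + (if i mod int M = r \<and> 2 \<le> gaps x i then 1 else 0)"

lemma hole_map_mono:
  assumes "hole_map N M x" "i < j"
  shows "x i < x j"
proof -
  have "x i < x (i + 1 + int n)" for n
  proof (induction n)
    case 0
    then show ?case using assms by (simp add: hole_map_def)
  next
    case (Suc n)
    have "x (i + 1 + int n) < x (i + 1 + int n + 1)"
      using assms(1) unfolding hole_map_def by blast
    then show ?case using Suc by (simp add: algebra_simps)
  qed
  from this[of "nat (j - i - 1)"] show ?thesis using assms(2) by simp
qed

lemma hole_map_less_iff: "hole_map N M x \<Longrightarrow> x i < x j \<longleftrightarrow> i < j"
  using hole_map_mono by (metis less_asym linorder_neqE_linordered_idom)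

lemma hole_map_eq_iff: "hole_map N M x \<Longrightarrow> x i = x j \<longleftrightarrow> i = j"
  using hole_map_less_iff by (metis less_irrefl linorder_neqE_linordered_idom)

lemma hole_map_mult:
  assumes "hole_map N M x"
  shows "x (i + z * int M) = x i + z * int N"
proof -
  have nat: "x (j + int n * int M) = x j + int n * int N" for n j
  proof (induction n)
    case (Suc n)
    have "x ((j + int n * int M) + int M) = x (j + int n * int M) + int N"
      using assms unfolding hole_map_def by blast
    then show ?case using Suc by (simp add: algebra_simps)
  qed simp
  show ?thesis
  proof (cases "0 \<le> z")
    case True
    then show ?thesis using nat[of i "nat z"] by simp
  next
    case False
    then show ?thesis using nat[of "i + z * int M" "nat (- z)"] by (simp add: algebra_simps)
  qed
qed

lemma hole_map_range_shift:
  assumes "hole_map N M x"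
  shows "w + z * int N \<in> range x \<longleftrightarrow> w \<in> range x"
proof -
  have "v + y * int N \<in> range x" if "v \<in> range x" for v y
    using that hole_map_mult[OF assms] by (metis rangeE rangeI)
  from this[of w z] this[of "w + z * int N" "- z"] show ?thesis by auto
qed

lemma hole_map_range_mod:
  assumes "hole_map N M x"
  shows "w mod int N \<in> range x \<longleftrightarrow> w \<in> range x"
  using hole_map_range_shift[OF assms, of "w mod int N" "w div int N"] by simp

lemma hole_map_mod_eq_iff:
  assumes "hole_map N M x"
  shows "x i mod int N = x j mod int N \<longleftrightarrow> i mod int M = j mod int M"
proof
  assume "x i mod int N = x j mod int N"
  then obtain z where "x i = x j + z * int N" by (metis mod_eqE mult.commute)
  then have "x i = x (j + z * int M)" using hole_map_mult[OF assms] by simp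
  then have "i = j + z * int M" using hole_map_eq_iff[OF assms] by blast
  then show "i mod int M = j mod int M" by simp
next
  assume "i mod int M = j mod int M"
  then obtain z where "i = j + z * int M" by (metis mod_eqE mult.commute)
  then show "x i mod int N = x j mod int N" using hole_map_mult[OF assms] by simp
qed

lemma hole_map_bij:
  assumes "hole_map N M x" "0 < N" "0 < M"
  shows "bij_betw (\<lambda>r. x (r + s) mod int N) {0..<int M} {w \<in> torus N. w \<in> range x}"
proof (rule bij_betw_imageI)
  show "inj_on (\<lambda>r. x (r + s) mod int N) {0..<int M}"
  proof (rule inj_onI)
    fix r r' assume r: "r \<in> {0..<int M}" "r' \<in> {0..<int M}"
      "x (r + s) mod int N = x (r' + s) mod int N"
    then have "(r + s) mod int M = (r' + s) mod int M"
      using hole_map_mod_eq_iff[OF assms(1)] by blast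
    then have "r mod int M = r' mod int M"
      by (metis add_diff_cancel_right' mod_diff_left_eq)
    then show "r = r'" using r by simp
  qed
  show "(\<lambda>r. x (r + s) mod int N) ` {0..<int M} = {w \<in> torus N. w \<in> range x}"
  proof (intro equalityI subsetI)
    fix w assume "w \<in> (\<lambda>r. x (r + s) mod int N) ` {0..<int M}"
    then show "w \<in> {w \<in> torus N. w \<in> range x}"
      using assms hole_map_range_mod[OF assms(1)] by (auto simp: torus_def)
  next
    fix w assume w: "w \<in> {w \<in> torus N. w \<in> range x}"
    then obtain i where i: "w = x i" by blast
    have "((i - s) mod int M + s) mod int M = i mod int M" by (simp add: mod_simps)
    then have "x ((i - s) mod int M + s) mod int N = x i mod int N"
      using hole_map_mod_eq_iff[OF assms(1)] by blast
    also have "\<dots> = w" using w i by (simp add: torus_def)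
    finally show "w \<in> (\<lambda>r. x (r + s) mod int N) ` {0..<int M}"
      using assms(3) by (intro image_eqI[of _ _ "(i - s) mod int M"]) auto
  qed
qed

lemma config_of_mod:
  assumes "hole_map N M x" "0 < N"
  shows "config_of N x (w mod int N) = (if w \<in> range x then 0 else 1)"
  using assms hole_map_range_mod[OF assms(1)] by (simp add: config_of_def torus_def)

lemma gaps_int: "hole_map N M x \<Longrightarrow> int (gaps x i) = x (i + 1) - x i - 1"
  unfolding hole_map_def gaps_def by (metis int_nat_eq diff_ge_0_iff_ge zle_diff1_eq add.commute add_le_imp_le_diff zless_imp_add1_zle le_diff_eq)

lemma gaps_periodic:
  assumes "hole_map N M x"
  shows "periodic M (gaps x)"
  unfolding periodic_def
proof
  fix i
  have "x (i + 1 + int M) = x (i + 1) + int N" "x (i + int M) = x i + int N"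
    using assms unfolding hole_map_def by blast+
  then show "gaps x (i + int M) = gaps x i" by (simp add: gaps_def algebra_simps)
qed

lemma gaps_shift: "hole_map N M x \<Longrightarrow> gaps x (i + z * int M) = gaps x i"
  by (rule periodic_mult[OF gaps_periodic])

lemma hole_map_push_right:
  assumes "hole_map N M x"
  shows "hole_map N M (push_right M r x)" "gaps (push_right M r x) = hop M r 1 (gaps x)"
proof -
  have lt: "push_right M r x i < push_right M r x (i + 1)
      \<and> push_right M r x (i + 1) - push_right M r x i - 1 = int (hop M r 1 (gaps x) i)" for i
    using gaps_int[OF assms, of i] by (auto simp: push_right_def hop_def)
  have "push_right M r x (i + int M) = push_right M r x i + int N" for i
    using assms gaps_shift[OF assms, of "i - 1" 1]
    by (simp add: push_right_def hole_map_def algebra_simps)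
       (metis add.commute add_diff_eq mod_add_self2 diff_add_eq)
  then show "hole_map N M (push_right M r x)" using lt by (simp add: hole_map_def)
  show "gaps (push_right M r x) = hop M r 1 (gaps x)"
    by (rule ext) (simp add: gaps_def lt)
qed

lemma hole_map_push_left:
  assumes "hole_map N M x"
  shows "hole_map N M (push_left M r x)" "gaps (push_left M r x) = hop M r (-1) (gaps x)"
proof -
  have lt: "push_left M r x i < push_left M r x (i + 1)
      \<and> push_left M r x (i + 1) - push_left M r x i - 1 = int (hop M r (-1) (gaps x) i)" for i
    using gaps_int[OF assms, of i] by (auto simp: push_left_def hop_def)
  have "push_left M r x (i + int M) = push_left M r x i + int N" for i
    using assms gaps_shift[OF assms, of i 1] by (simp add: push_left_def hole_map_def)
  then show "hole_map N M (push_left M r x)" using lt by (simp add: hole_map_def)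
  show "gaps (push_left M r x) = hop M r (-1) (gaps x)"
    by (rule ext) (simp add: gaps_def lt)
qed

lemma range_push_right:
  assumes x: "hole_map N M x" and r: "r \<in> {0..<int M}" "2 \<le> gaps x r"
  shows "w \<in> range (push_right M r x) \<longleftrightarrow>
    (w \<in> range x \<and> w mod int N \<noteq> x (r + 1) mod int N) \<or> w mod int N = (x (r + 1) - 1) mod int N"
proof -
  have shifted: "push_right M r x i = x i - 1" if "i = r + 1 + z * int M" for i z
  proof -
    have "i - 1 = r + z * int M" using that by simp
    then have "(i - 1) mod int M = r" "gaps x (i - 1) = gaps x r"
      using r(1) gaps_shift[OF x] by simp_all
    then show ?thesis using r(2) by (simp add: push_right_def)
  qed
  \<comment> \<open>On the circle the moved holes are exactly the translates of the hole with index \<open>r + 1\<close>.\<close>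
  have mod_iff: "x i mod int N = x (r + 1) mod int N \<longleftrightarrow> (i - 1) mod int M = r" for i
  proof -
    have "i mod int M = (r + 1) mod int M \<longleftrightarrow> (i - 1) mod int M = r mod int M"
      by (metis add_diff_cancel_right' diff_add_cancel mod_add_left_eq mod_diff_left_eq)
    then show ?thesis using hole_map_mod_eq_iff[OF x] r(1) by simp
  qed
  show ?thesis
  proof
    assume "w \<in> range (push_right M r x)"
    then obtain i where i: "w = push_right M r x i" by blast
    show "(w \<in> range x \<and> w mod int N \<noteq> x (r + 1) mod int N) \<or> w mod int N = (x (r + 1) - 1) mod int N"
    proof (cases "(i - 1) mod int M = r")
      case True
      then have "x i mod int N = x (r + 1) mod int N" using mod_iff by blast
      moreover have "i = r + 1 + ((i - 1) div int M) * int M"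
        using True div_mult_mod_eq[of "i - 1" "int M"] by linarith
      then have "w = x i - 1" using i shifted by blast
      ultimately show ?thesis by (metis mod_diff_left_eq)
    next
      case False
      then have "w = x i" using i by (simp add: push_right_def)
      then show ?thesis using False mod_iff by blast
    qed
  next
    assume "(w \<in> range x \<and> w mod int N \<noteq> x (r + 1) mod int N) \<or> w mod int N = (x (r + 1) - 1) mod int N"
    then show "w \<in> range (push_right M r x)"
    proof
      assume "w \<in> range x \<and> w mod int N \<noteq> x (r + 1) mod int N"
      then obtain i where i: "w = x i" "(i - 1) mod int M \<noteq> r" using mod_iff by blast
      then have "w = push_right M r x i" by (simp add: push_right_def)
      then show ?thesis by blast
    next
      assume "w mod int N = (x (r + 1) - 1) mod int N"
      then obtain z where z: "w = x (r + 1) - 1 + z * int N" by (metis mod_eqE mult.commute)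
      have "w = push_right M r x (r + 1 + z * int M)"
        unfolding shifted[OF refl] hole_map_mult[OF x] z by simp
      then show ?thesis by blast
    qed
  qed
qed

lemma range_push_left:
  assumes x: "hole_map N M x" and r: "r \<in> {0..<int M}" "2 \<le> gaps x r"
  shows "w \<in> range (push_left M r x) \<longleftrightarrow>
    (w \<in> range x \<and> w mod int N \<noteq> x r mod int N) \<or> w mod int N = (x r + 1) mod int N"
proof -
  have shifted: "push_left M r x i = x i + 1" if "i = r + z * int M" for i z
    using that r gaps_shift[OF x, of r z] by (simp add: push_left_def)
  have mod_iff: "x i mod int N = x r mod int N \<longleftrightarrow> i mod int M = r" for i
    using hole_map_mod_eq_iff[OF x] r(1) by simp
  show ?thesis
  proof
    assume "w \<in> range (push_left M r x)"
    then obtain i where i: "w = push_left M r x i" by blast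
    show "(w \<in> range x \<and> w mod int N \<noteq> x r mod int N) \<or> w mod int N = (x r + 1) mod int N"
    proof (cases "i mod int M = r")
      case True
      then have "x i mod int N = x r mod int N" using mod_iff by blast
      moreover have "i = r + (i div int M) * int M"
        using True div_mult_mod_eq[of i "int M"] by linarith
      then have "w = x i + 1" using i shifted by blast
      ultimately show ?thesis by (metis mod_add_left_eq)
    next
      case False
      then have "w = x i" using i by (simp add: push_left_def)
      then show ?thesis using False mod_iff by blast
    qed
  next
    assume "(w \<in> range x \<and> w mod int N \<noteq> x r mod int N) \<or> w mod int N = (x r + 1) mod int N"
    then show "w \<in> range (push_left M r x)"
    proof
      assume "w \<in> range x \<and> w mod int N \<noteq> x r mod int N"
      then obtain i where i: "w = x i" "i mod int M \<noteq> r" using mod_iff by blast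
      then have "w = push_left M r x i" by (simp add: push_left_def)
      then show ?thesis by blast
    next
      assume "w mod int N = (x r + 1) mod int N"
      then obtain z where z: "w = x r + 1 + z * int N" by (metis mod_eqE mult.commute)
      have "w = push_left M r x (r + z * int M)"
        unfolding shifted[OF refl] hole_map_mult[OF x] z by simp
      then show ?thesis by blast
    qed
  qed
qed

lemma bij_nxt: "0 < N \<Longrightarrow> bij_betw (nxt N) (torus N) (torus N)"
  by (rule bij_betw_byWitness[where f' = "prv N"]) (auto simp: nxt_def prv_def torus_def mod_simps)

lemma bij_prv: "0 < N \<Longrightarrow> bij_betw (prv N) (torus N) (torus N)"
  by (rule bij_betw_byWitness[where f' = "nxt N"]) (auto simp: nxt_def prv_def torus_def mod_simps)

lemma nxt_mod: "nxt N (w mod int N) = (w + 1) mod int N"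
  by (simp add: nxt_def mod_simps)

lemma prv_mod: "prv N (w mod int N) = (w - 1) mod int N"
  by (simp add: prv_def mod_simps)

text \<open>
  A jump to the right requires a hole next to the particle, so the sum over sites in the
  generator is a sum over the holes of one period.
\<close>
lemma sum_before_holes:
  fixes G :: "int \<Rightarrow> real"
  assumes x: "hole_map N M x" and N: "0 < N" and M: "0 < M"
    and G: "\<And>w. w \<in> torus N \<Longrightarrow> w \<notin> range x \<Longrightarrow> G (prv N w) = 0"
  shows "(\<Sum>z\<in>torus N. G z) = (\<Sum>r\<in>{0..<int M}. G ((x (r + 1) - 1) mod int N))"
proof -
  let ?H = "{w \<in> torus N. w \<in> range x}"
  have "(\<Sum>z\<in>torus N. G z) = (\<Sum>w\<in>torus N. G (prv N w))"
    by (rule sum.reindex_bij_betw[OF bij_prv[OF N], symmetric])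
  also have "\<dots> = (\<Sum>w\<in>?H. G (prv N w))"
    by (rule sum.mono_neutral_right) (use G in \<open>auto simp: torus_def\<close>)
  also have "\<dots> = (\<Sum>r\<in>{0..<int M}. G (prv N (x (r + 1) mod int N)))"
    by (rule sum.reindex_bij_betw[OF hole_map_bij[OF x N M, of 1], symmetric])
  finally show ?thesis by (simp add: prv_mod)
qed

lemma sum_after_holes:
  fixes G :: "int \<Rightarrow> real"
  assumes x: "hole_map N M x" and N: "0 < N" and M: "0 < M"
    and G: "\<And>w. w \<in> torus N \<Longrightarrow> w \<notin> range x \<Longrightarrow> G (nxt N w) = 0"
  shows "(\<Sum>z\<in>torus N. G z) = (\<Sum>r\<in>{0..<int M}. G ((x r + 1) mod int N))"
proof -
  let ?H = "{w \<in> torus N. w \<in> range x}"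
  have "(\<Sum>z\<in>torus N. G z) = (\<Sum>w\<in>torus N. G (nxt N w))"
    by (rule sum.reindex_bij_betw[OF bij_nxt[OF N], symmetric])
  also have "\<dots> = (\<Sum>w\<in>?H. G (nxt N w))"
    by (rule sum.mono_neutral_right) (use G in \<open>auto simp: torus_def\<close>)
  also have "\<dots> = (\<Sum>r\<in>{0..<int M}. G (nxt N (x (r + 0) mod int N)))"
    by (rule sum.reindex_bij_betw[OF hole_map_bij[OF x N M, of 0], symmetric])
  finally show ?thesis by (simp add: nxt_mod)
qed

lemma between_holes:
  assumes x: "hole_map N M x" and "x r < w" "w < x (r + 1)"
  shows "w \<notin> range x"
proof
  assume "w \<in> range x"
  then obtain i where "w = x i" by blast
  then have "r < i" "i < r + 1" using assms hole_map_less_iff[OF x] by auto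
  then show False by simp
qed

lemma exchange_push_right:
  assumes x: "hole_map N M x" and N: "0 < N" and r: "r \<in> {0..<int M}" "2 \<le> gaps x r"
  shows "exchange (config_of N x) ((x (r + 1) - 1) mod int N) (x (r + 1) mod int N)
    = config_of N (push_right M r x)"
proof
  fix z
  let ?y = "x (r + 1)"
  have gap: "3 \<le> ?y - x r" using gaps_int[OF x, of r] r by linarith
  have vy: "config_of N x (?y mod int N) = 0"
    using config_of_mod[OF x N] by simp
  have "?y - 1 \<notin> range x" by (rule between_holes[OF x, of r]) (use gap in auto)
  then have vy1: "config_of N x ((?y - 1) mod int N) = 1"
    using config_of_mod[OF x N] by simp
  have ne: "(?y - 1) mod int N \<noteq> ?y mod int N" using vy vy1 by force
  have x': "hole_map N M (push_right M r x)" by (rule hole_map_push_right[OF x])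
  show "exchange (config_of N x) ((?y - 1) mod int N) (?y mod int N) z
      = config_of N (push_right M r x) z"
  proof (cases "z \<in> torus N")
    case False
    then have "z \<noteq> w mod int N" for w using N by (auto simp: torus_def)
    then show ?thesis using False by (simp add: exchange_def config_of_def)
  next
    case True
    then have zm: "z mod int N = z" by (simp add: torus_def)
    show ?thesis
      using True vy vy1 ne range_push_right[OF x r, of z]
      by (auto simp: exchange_def zm config_of_def)
  qed
qed

lemma exchange_push_left:
  assumes x: "hole_map N M x" and N: "0 < N" and r: "r \<in> {0..<int M}" "2 \<le> gaps x r"
  shows "exchange (config_of N x) ((x r + 1) mod int N) (x r mod int N)
    = config_of N (push_left M r x)"
proof
  fix z
  let ?y = "x r"
  have gap: "3 \<le> x (r + 1) - ?y" using gaps_int[OF x, of r] r by linarith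
  have vy: "config_of N x (?y mod int N) = 0"
    using config_of_mod[OF x N] by simp
  have "?y + 1 \<notin> range x" by (rule between_holes[OF x, of r]) (use gap in auto)
  then have vy1: "config_of N x ((?y + 1) mod int N) = 1"
    using config_of_mod[OF x N] by simp
  have ne: "(?y + 1) mod int N \<noteq> ?y mod int N" using vy vy1 by force
  show "exchange (config_of N x) ((?y + 1) mod int N) (?y mod int N) z
      = config_of N (push_left M r x) z"
  proof (cases "z \<in> torus N")
    case False
    then have "z \<noteq> w mod int N" for w using N by (auto simp: torus_def)
    then show ?thesis using False by (simp add: exchange_def config_of_def)
  next
    case True
    then have zm: "z mod int N = z" by (simp add: torus_def)
    show ?thesis
      using True vy vy1 ne range_push_left[OF x r, of z]
      by (auto simp: exchange_def zm config_of_def)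
  qed
qed

lemma push_idle:
  assumes "r \<in> {0..<int M}" "\<not> 2 \<le> gaps x r" "hole_map N M x"
  shows "push_right M r x = x" "push_left M r x = x"
proof -
  have *: "\<not> 2 \<le> gaps x i" if "i mod int M = r" for i
    using that periodic_mod[OF gaps_periodic[OF assms(3)], of i] assms(2) by simp
  show "push_right M r x = x" "push_left M r x = x"
    using * by (auto simp: push_right_def push_left_def fun_eq_iff)
qed

lemma rate_right:
  assumes x: "hole_map N M x" and N: "0 < N" and r: "r \<in> {0..<int M}"
  defines "\<xi> \<equiv> config_of N x" and "z \<equiv> (x (r + 1) - 1) mod int N"
  shows "1/2 * real (\<xi> z) * real (\<xi> (prv N z)) * (1 - real (\<xi> (nxt N z))) * (f (exchange \<xi> z (nxt N z)) - f \<xi>)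
    = 1/2 * (f (config_of N (push_right M r x)) - f \<xi>)"
proof (cases "2 \<le> gaps x r")
  case True
  then have gap: "3 \<le> x (r + 1) - x r" using gaps_int[OF x, of r] by linarith
  have "x (r + 1) - 1 \<notin> range x" "x (r + 1) - 2 \<notin> range x"
    by (rule between_holes[OF x, of r]; use gap in simp)+
  then have "\<xi> z = 1" "\<xi> (prv N z) = 1" "\<xi> (nxt N z) = 0"
    unfolding \<xi>_def z_def nxt_mod prv_mod using config_of_mod[OF x N] by auto
  moreover have "exchange \<xi> z (nxt N z) = config_of N (push_right M r x)"
    unfolding \<xi>_def z_def nxt_mod using exchange_push_right[OF x N r True] by simp
  ultimately show ?thesis by simp
next
  case False
  then have "gaps x r = 0 \<or> gaps x r = 1" by linarith
  then have "x (r + 1) - 1 = x r \<or> x (r + 1) - 2 = x r" using gaps_int[OF x, of r] by linarith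
  then have "x (r + 1) - 1 \<in> range x \<or> x (r + 1) - 2 \<in> range x" by (metis rangeI)
  then have "\<xi> z = 0 \<or> \<xi> (prv N z) = 0"
    unfolding \<xi>_def z_def prv_mod using config_of_mod[OF x N] by auto
  then show ?thesis using push_idle[OF r False x] by (auto simp: \<xi>_def)
qed

lemma rate_left:
  assumes x: "hole_map N M x" and N: "0 < N" and r: "r \<in> {0..<int M}"
  defines "\<xi> \<equiv> config_of N x" and "z \<equiv> (x r + 1) mod int N"
  shows "1/2 * real (\<xi> z) * real (\<xi> (nxt N z)) * (1 - real (\<xi> (prv N z))) * (f (exchange \<xi> z (prv N z)) - f \<xi>)
    = 1/2 * (f (config_of N (push_left M r x)) - f \<xi>)"
proof -
  have two: "x r + 1 + 1 = x r + 2" by simp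
  show ?thesis
  proof (cases "2 \<le> gaps x r")
    case True
    then have gap: "3 \<le> x (r + 1) - x r" using gaps_int[OF x, of r] by linarith
    have "x r + 1 \<notin> range x" "x r + 2 \<notin> range x"
      by (rule between_holes[OF x, of r]; use gap in simp)+
    then have "\<xi> z = 1" "\<xi> (nxt N z) = 1" "\<xi> (prv N z) = 0"
      unfolding \<xi>_def z_def nxt_mod prv_mod two using config_of_mod[OF x N] by auto
    moreover have "exchange \<xi> z (prv N z) = config_of N (push_left M r x)"
      unfolding \<xi>_def z_def prv_mod using exchange_push_left[OF x N r True] by simp
    ultimately show ?thesis by simp
  next
    case False
    then have "gaps x r = 0 \<or> gaps x r = 1" by linarith
    then have "x (r + 1) = x r + 1 \<or> x (r + 1) = x r + 2" using gaps_int[OF x, of r] by linarith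
    then have "x r + 1 \<in> range x \<or> x r + 2 \<in> range x" by (metis rangeI)
    then have "\<xi> z = 0 \<or> \<xi> (nxt N z) = 0"
      unfolding \<xi>_def z_def nxt_mod two using config_of_mod[OF x N] by auto
    then show ?thesis using push_idle[OF r False x] by (auto simp: \<xi>_def)
  qed
qed

text \<open>On functions of the run lengths, the exclusion process acts as the run process.\<close>
lemma sfep_generator_config_of:
  assumes x: "hole_map N M x" and N: "0 < N" and M: "0 < M"
    and f: "\<And>y. hole_map N M y \<Longrightarrow> f (config_of N y) = g (gaps y)"
  shows "sfep_generator N f (config_of N x) = real M * (hop_mean M g (gaps x) - g (gaps x))"
proof -
  let ?\<xi> = "config_of N x"
  have "w \<notin> range x \<Longrightarrow> w \<in> torus N \<Longrightarrow> ?\<xi> w = 1" for w by (simp add: config_of_def)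
  moreover have "w \<in> torus N \<Longrightarrow> nxt N (prv N w) = w \<and> prv N (nxt N w) = w" for w
    by (simp add: nxt_def prv_def torus_def mod_simps)
  ultimately have one: "?\<xi> (nxt N (prv N w)) = 1" "?\<xi> (prv N (nxt N w)) = 1"
    if "w \<in> torus N" "w \<notin> range x" for w using that by simp_all
  have "sfep_generator N f ?\<xi>
     = (\<Sum>r\<in>{0..<int M}. 1/2 * (f (config_of N (push_right M r x)) - f ?\<xi>))
     + (\<Sum>r\<in>{0..<int M}. 1/2 * (f (config_of N (push_left M r x)) - f ?\<xi>))"
    unfolding sfep_generator_def
    by (subst sum_before_holes[OF x N M], simp add: one, subst sum_after_holes[OF x N M], simp add: one,
        rule arg_cong2[where f = "(+)"]; intro sum.cong refl rate_right[OF x N] rate_left[OF x N])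
  also have "\<dots> = (\<Sum>r\<in>{0..<int M}. 1/2 * (g (hop M r 1 (gaps x)) - g (gaps x)))
     + (\<Sum>r\<in>{0..<int M}. 1/2 * (g (hop M r (-1) (gaps x)) - g (gaps x)))"
    using hole_map_push_right[OF x] hole_map_push_left[OF x] f x by simp
  also have "\<dots> = real M * (hop_mean M g (gaps x) - g (gaps x))"
    using M by (simp add: hop_mean_def sum.distrib sum_subtractf sum_divide_distrib[symmetric] field_simps)
  finally show ?thesis .
qed

lemma sfep_generator_power_config_of:
  assumes N: "0 < N" and M: "0 < M"
    and f: "\<And>y. hole_map N M y \<Longrightarrow> f (config_of N y) = g (gaps y)"
    and x: "hole_map N M x"
  shows "(sfep_generator N ^^ n) f (config_of N x)
    = ((\<lambda>h \<eta>. real M * (hop_mean M h \<eta> - h \<eta>)) ^^ n) g (gaps x)"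
  using x
proof (induction n arbitrary: x)
  case 0
  then show ?case using f by simp
next
  case (Suc n)
  show ?case
    using sfep_generator_config_of[of N M x "(sfep_generator N ^^ n) f"
        "((\<lambda>h \<eta>. real M * (hop_mean M h \<eta> - h \<eta>)) ^^ n) g", OF Suc.prems N M Suc.IH]
    by simp
qed

lemma indicator_nonergodic_config_of:
  assumes x: "hole_map N M x" and N: "0 < N" and M: "0 < M" and k: "k + M = N"
  shows "indicator (nonergodic N k) (config_of N x) = has_gap (gaps x)"
proof -
  let ?\<xi> = "config_of N x" and ?H = "{w \<in> torus N. w \<in> range x}"
  have fin: "finite (torus N)" by (simp add: torus_def)
  have "card ?H = M"
    using bij_betw_same_card[OF hole_map_bij[OF x N M, of 0]] by simp
  moreover have "(\<Sum>w\<in>torus N. ?\<xi> w) = card (torus N - ?H)"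
  proof -
    have "(\<Sum>w\<in>torus N. ?\<xi> w) = (\<Sum>w\<in>torus N - ?H. 1)"
      by (rule sum.mono_neutral_cong_right) (auto simp: config_of_def fin)
    then show ?thesis by simp
  qed
  moreover have "card (torus N - ?H) = card (torus N) - card ?H"
    by (rule card_Diff_subset) (use fin in \<open>auto intro: finite_subset\<close>)
  moreover have "card (torus N) = N" by (simp add: torus_def)
  ultimately have "(\<Sum>w\<in>torus N. ?\<xi> w) = k"
    using k by linarith
  then have conf: "?\<xi> \<in> configs N k"
    by (auto simp: configs_def config_of_def)
  have "(\<exists>z\<in>torus N. ?\<xi> z + ?\<xi> (nxt N z) < 1) \<longleftrightarrow> (\<exists>i. gaps x i = 0)"
  proof
    assume "\<exists>z\<in>torus N. ?\<xi> z + ?\<xi> (nxt N z) < 1"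
    then obtain z where z: "z \<in> torus N" "?\<xi> z = 0" "?\<xi> (nxt N z) = 0" by auto
    have "z \<in> range x" using z(1,2) by (simp add: config_of_def split: if_splits)
    moreover have "z + 1 \<in> range x"
      using z(3) config_of_mod[OF x N, of "z + 1"] by (simp add: nxt_def split: if_splits)
    ultimately obtain i j where ij: "z = x i" "z + 1 = x j" by blast
    then have "i < j" using hole_map_less_iff[OF x, of i j] by simp
    moreover have "\<not> i + 1 < j"
    proof
      assume "i + 1 < j"
      then have "x (i + 1) < x j" using hole_map_mono[OF x] by blast
      moreover have "x i < x (i + 1)" using hole_map_mono[OF x] by simp
      ultimately show False using ij by simp
    qed
    ultimately have "j = i + 1" by simp
    then have "gaps x i = 0" using ij by (simp add: gaps_def)
    then show "\<exists>i. gaps x i = 0" by blast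
  next
    assume "\<exists>i. gaps x i = 0"
    then obtain i where "gaps x i = 0" by blast
    then have i: "x (i + 1) = x i + 1" using gaps_int[OF x, of i] by simp
    let ?z = "x i mod int N"
    have "?\<xi> ?z = 0" using config_of_mod[OF x N] by simp
    moreover have "?\<xi> (nxt N ?z) = 0"
      unfolding nxt_mod i[symmetric] using config_of_mod[OF x N] by simp
    moreover have "?z \<in> torus N" using N by (simp add: torus_def)
    ultimately show "\<exists>z\<in>torus N. ?\<xi> z + ?\<xi> (nxt N z) < 1" by force
  qed
  then have "?\<xi> \<in> nonergodic N k \<longleftrightarrow> (\<exists>i. gaps x i = 0)"
    using conf by (auto simp: nonergodic_def ergodic_component_def not_le)
  then show ?thesis by (simp add: has_gap_def indicator_def)
qed

lemma exists_hole_map: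
  assumes \<xi>: "\<xi> \<in> configs N k" and N: "0 < N" and M: "0 < M" and k: "k + M = N"
  obtains x where "hole_map N M x" "config_of N x = \<xi>"
proof -
  have \<xi>PiE: "\<xi> \<in> torus N \<rightarrow>\<^sub>E {0, 1}" and sum: "(\<Sum>z\<in>torus N. \<xi> z) = k"
    using \<xi> by (auto simp: configs_def)
  define H where "H = {z\<in>torus N. \<xi> z = 0}"
  have fin: "finite H" "finite (torus N)"
    by (rule finite_subset[of _ "torus N"]) (auto simp: H_def torus_def)
  have val: "\<xi> z = 0 \<or> \<xi> z = 1" if "z \<in> torus N" for z using \<xi>PiE that by auto
  have "(\<Sum>z\<in>torus N. \<xi> z) = (\<Sum>z\<in>torus N - H. 1)"
    by (rule sum.mono_neutral_cong_right) (use val in \<open>force simp: fin H_def\<close>)+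
  then have "card (torus N - H) = k" using sum by simp
  moreover have "card (torus N) = N" by (simp add: torus_def)
  moreover have "card H \<le> card (torus N)" by (rule card_mono) (auto simp: fin H_def)
  ultimately have cardH: "card H = M"
    using k card_Diff_subset[of H "torus N"] fin by (simp add: H_def)
  define hs where "hs = sorted_list_of_set H"
  have hs: "sorted_wrt (<) hs" "set hs = H" "length hs = M"
    using fin cardH by (simp_all add: hs_def)
  define x where "x = (\<lambda>i. hs ! nat (i mod int M) + int N * (i div int M))"
  have in_H: "hs ! nat (i mod int M) \<in> H" for i
    using hs M by (metis nth_mem Euclidean_Rings.pos_mod_bound Euclidean_Rings.pos_mod_sign nat_less_iff of_nat_0_less_iff)
  have bnd: "0 \<le> hs ! nat (i mod int M)" "hs ! nat (i mod int M) < int N" for i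
    using in_H[of i] by (auto simp: H_def torus_def)
  have step: "x i < x (i + 1)" for i
  proof (cases "i mod int M + 1 = int M")
    case True
    then have "i + 1 = i div int M * int M + int M"
      using div_mult_mod_eq[of i "int M"] by linarith
    then have "i + 1 = (i div int M + 1) * int M"
      by (simp add: distrib_right)
    then have "(i + 1) div int M = i div int M + 1" using M by simp
    then show ?thesis using bnd[of i] bnd[of "i + 1"] by (simp add: x_def algebra_simps)
  next
    case False
    then have lt: "i mod int M + 1 < int M" using M pos_mod_bound[of "int M" i] by linarith
    have eq: "i + 1 = (i mod int M + 1) + (i div int M) * int M"
      using div_mult_mod_eq[of i "int M"] by simp
    have "0 \<le> i mod int M" using M by simp
    then have small: "(i mod int M + 1) mod int M = i mod int M + 1" "(i mod int M + 1) div int M = 0"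
      using lt by (simp_all only: mod_pos_pos_trivial div_pos_pos_trivial)
    have "(i + 1) mod int M = i mod int M + 1"
      by (subst eq) (simp only: mod_mult_self1 small)
    moreover have "(i + 1) div int M = i div int M"
      by (subst eq) (use M in \<open>simp only: div_mult_self1 small of_nat_eq_0_iff add_0_right\<close>)
    moreover have "hs ! nat (i mod int M) < hs ! nat (i mod int M + 1)"
      using hs lt \<open>0 \<le> i mod int M\<close> by (intro sorted_wrt_nth_less[OF hs(1)]) auto
    ultimately show ?thesis by (simp add: x_def)
  qed
  have x: "hole_map N M x"
    using step M by (simp add: hole_map_def x_def distrib_left)
  have "z \<in> range x \<longleftrightarrow> \<xi> z = 0" if z: "z \<in> torus N" for z
  proof
    assume "z \<in> range x"
    then obtain i where i: "z = x i" by blast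
    then have "z mod int N = hs ! nat (i mod int M)" using bnd[of i] by (simp add: x_def)
    then have "z = hs ! nat (i mod int M)" using z by (simp add: torus_def)
    then show "\<xi> z = 0" using in_H[of i] by (simp add: H_def)
  next
    assume "\<xi> z = 0"
    then have "z \<in> set hs" using z hs by (simp add: H_def)
    then obtain n where n: "n < M" "hs ! n = z" using hs by (metis in_set_conv_nth)
    then have "x (int n) = z" by (simp add: x_def)
    then show "z \<in> range x" by blast
  qed
  moreover have "\<xi> z = undefined" if "z \<notin> torus N" for z using \<xi>PiE that by auto
  ultimately have "config_of N x = \<xi>" using val unfolding config_of_def fun_eq_iff by metis
  then show ?thesis using x that by blast
qed

section \<open>Ergodic regions\<close>

text \<open>
  An unrolled ergodic interval; the condition is a statement about integer intervals and needs
  no case distinction for wrapping around the circle.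
\<close>
definition segment :: "nat \<Rightarrow> config \<Rightarrow> int \<Rightarrow> int \<Rightarrow> bool" where
  "segment N \<xi> u v \<longleftrightarrow> u \<le> v \<and> \<xi> (u mod int N) = 1 \<and> \<xi> (v mod int N) = 1 \<and>
     (\<forall>w. u \<le> w \<and> w < v \<longrightarrow> 1 \<le> \<xi> (w mod int N) + \<xi> ((w + 1) mod int N))"

lemma segment_shift:
  assumes "segment N \<xi> u v"
  shows "segment N \<xi> (u + z * int N) (v + z * int N)"
proof -
  have "1 \<le> \<xi> (w mod int N) + \<xi> ((w + 1) mod int N)"
    if "u + z * int N \<le> w" "w < v + z * int N" for w
  proof -
    define y where "y = w - z * int N"
    have "1 \<le> \<xi> (y mod int N) + \<xi> ((y + 1) mod int N)"
      using assms that by (auto simp: segment_def y_def)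
    moreover have "w = y + z * int N" "w + 1 = (y + 1) + z * int N" by (simp_all add: y_def)
    ultimately show ?thesis by (simp only: mod_mult_self1)
  qed
  then show ?thesis using assms by (simp add: segment_def)
qed

lemma segment_Un:
  assumes "segment N \<xi> u v" "segment N \<xi> u' v'" "u \<le> w" "w \<le> v" "u' \<le> w" "w \<le> v'"
  shows "segment N \<xi> (min u u') (max v v')"
proof -
  have "1 \<le> \<xi> (y mod int N) + \<xi> ((y + 1) mod int N)" if "min u u' \<le> y" "y < max v v'" for y
  proof -
    have "(u \<le> y \<and> y < v) \<or> (u' \<le> y \<and> y < v')" using that assms(3-6) by linarith
    then show ?thesis using assms(1,2) unfolding segment_def by blast
  qed
  then show ?thesis using assms by (auto simp: segment_def min_def max_def)
qed

text \<open>
  The two adjacent holes of a nonergodic configuration recur in every window of length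
  \<open>N\<close>.
\<close>
lemma segment_length:
  assumes "\<xi> \<in> nonergodic N k" "segment N \<xi> u v" "0 < N"
  shows "v - u < int N"
proof (rule ccontr)
  assume neg: "\<not> v - u < int N"
  obtain z where z: "z \<in> torus N" "\<xi> z + \<xi> (nxt N z) < 1"
    using assms(1) unfolding nonergodic_def ergodic_component_def by (auto simp: not_le)
  define w where "w = u + (z - u) mod int N"
  have "w mod int N = z" using z(1) by (simp add: w_def mod_simps torus_def)
  moreover from this have "(w + 1) mod int N = nxt N z" by (metis mod_add_left_eq nxt_def)
  moreover have "u \<le> w" using assms(3) by (simp add: w_def)
  moreover have "w < v"
    using neg pos_mod_bound[of "int N" "z - u"] assms(3) unfolding w_def by linarith
  ultimately have "1 \<le> \<xi> z + \<xi> (nxt N z)" using assms(2) unfolding segment_def by metis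
  then show False using z by simp
qed

lemma ergodic_interval_imp_segment:
  assumes "ergodic_interval N \<xi> I" "0 < N"
  obtains u v where "segment N \<xi> u v" "I = (\<lambda>w. w mod int N) ` {u..v}"
proof -
  obtain a b where ab: "a \<in> torus N" "b \<in> torus N" "I = cyc_interval N a b" "\<xi> a = 1" "\<xi> b = 1"
    and good: "\<And>z. z \<in> I \<Longrightarrow> nxt N z \<in> I \<Longrightarrow> 1 \<le> \<xi> z + \<xi> (nxt N z)"
    using assms(1) unfolding ergodic_interval_def by blast
  define v where "v = a + (b - a) mod int N"
  have I: "I = (\<lambda>w. w mod int N) ` {a..v}"
  proof -
    have "{a..v} = (\<lambda>j. a + j) ` {0..(b - a) mod int N}"
      unfolding v_def by (simp add: image_add_atLeastAtMost)
    then show ?thesis unfolding ab(3) cyc_interval_def by (simp only: image_image)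
  qed
  have "v mod int N = b" using ab(2) by (simp add: v_def mod_simps torus_def)
  moreover have "a mod int N = a" using ab(1) by (simp add: torus_def)
  moreover have "a \<le> v" using assms(2) by (simp add: v_def)
  moreover have "1 \<le> \<xi> (w mod int N) + \<xi> ((w + 1) mod int N)" if "a \<le> w" "w < v" for w
  proof -
    have "w mod int N \<in> I" "(w + 1) mod int N \<in> I" using that by (auto simp: I)
    then show ?thesis using good[of "w mod int N"] by (simp add: nxt_mod)
  qed
  ultimately have "segment N \<xi> a v" using ab by (simp add: segment_def)
  then show ?thesis using I that by blast
qed

lemma segment_imp_ergodic_interval:
  assumes seg: "segment N \<xi> u v" and len: "v - u < int N" and N: "0 < N"
  shows "ergodic_interval N \<xi> ((\<lambda>w. w mod int N) ` {u..v})"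
proof -
  let ?I = "(\<lambda>w. w mod int N) ` {u..v}"
  have "(v mod int N - u mod int N) mod int N = v - u"
    using seg len by (simp add: mod_simps segment_def)
  moreover have "{u..v} = (\<lambda>j. u + j) ` {0..v - u}" by (simp add: image_add_atLeastAtMost)
  ultimately have "?I = cyc_interval N (u mod int N) (v mod int N)"
    unfolding cyc_interval_def by (simp only: image_image mod_add_left_eq)
  moreover have "1 \<le> \<xi> z + \<xi> (nxt N z)" if "z \<in> ?I" for z
  proof -
    from that obtain w where w: "z = w mod int N" "u \<le> w" "w \<le> v" by auto
    show ?thesis
    proof (cases "w = v")
      case True
      then show ?thesis using seg w by (simp add: segment_def)
    next
      case False
      then show ?thesis using seg w by (simp add: segment_def nxt_mod)
    qed
  qed
  moreover have "u mod int N \<in> torus N" "v mod int N \<in> torus N" using N by (simp_all add: torus_def)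
  ultimately show ?thesis
    using seg unfolding ergodic_interval_def segment_def by blast
qed

lemma ergodic_intervals_Un:
  assumes \<xi>: "\<xi> \<in> nonergodic N k" and N: "0 < N"
    and I: "ergodic_interval N \<xi> I" "ergodic_interval N \<xi> I'" "I \<inter> I' \<noteq> {}"
  obtains L where "ergodic_interval N \<xi> L" "I \<union> I' \<subseteq> L"
proof -
  obtain u v where uv: "segment N \<xi> u v" "I = (\<lambda>w. w mod int N) ` {u..v}"
    using ergodic_interval_imp_segment[OF I(1) N] by blast
  obtain u' v' where uv': "segment N \<xi> u' v'" "I' = (\<lambda>w. w mod int N) ` {u'..v'}"
    using ergodic_interval_imp_segment[OF I(2) N] by blast
  obtain w w' where w: "u \<le> w" "w \<le> v" "u' \<le> w'" "w' \<le> v'" "w mod int N = w' mod int N"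
    using I(3) unfolding uv uv' by auto
  obtain z where z: "w = w' + z * int N" using w(5) by (metis mod_eqE mult.commute)
  let ?u = "u' + z * int N" and ?v = "v' + z * int N"
  have seg: "segment N \<xi> (min u ?u) (max v ?v)"
    by (rule segment_Un[OF uv(1) segment_shift[OF uv'(1)] w(1,2)]) (use w z in auto)
  let ?L = "(\<lambda>w. w mod int N) ` {min u ?u..max v ?v}"
  have "I' \<subseteq> ?L"
  proof
    fix y assume "y \<in> I'"
    then obtain t where "u' \<le> t" "t \<le> v'" "y = t mod int N" by (auto simp: uv')
    then show "y \<in> ?L" by (intro image_eqI[of _ _ "t + z * int N"]) auto
  qed
  moreover have "I \<subseteq> ?L" unfolding uv by (intro image_mono) auto
  ultimately show ?thesis
    using that segment_imp_ergodic_interval[OF seg segment_length[OF \<xi> seg N] N] by blast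
qed

lemma ergodic_interval_subset_torus:
  assumes "ergodic_interval N \<xi> I" "0 < N"
  shows "I \<subseteq> torus N"
proof -
  obtain u v where "I = (\<lambda>w. w mod int N) ` {u..v}"
    using ergodic_interval_imp_segment[OF assms] by blast
  then show ?thesis using assms(2) by (auto simp: torus_def)
qed

text \<open>
  Two regions that meet could be replaced by a single ergodic interval containing both, which
  contradicts minimality. Disjointness ensures that no particle is counted twice in the
  hypothesis on the number of particles.
\<close>
lemma ergodic_regions_disjoint:
  assumes \<xi>: "\<xi> \<in> nonergodic N k" and N: "0 < N" and R: "is_ergodic_regions N \<xi> R"
    and I: "I \<in> R" "I' \<in> R" "I \<noteq> I'"
  shows "I \<inter> I' = {}"
proof (rule ccontr)
  assume meet: "I \<inter> I' \<noteq> {}"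
  have cover: "ergodic_cover N \<xi> R" and least: "\<And>S. ergodic_cover N \<xi> S \<Longrightarrow> card R \<le> card S"
    using R unfolding is_ergodic_regions_def is_arg_min_def by (auto simp: not_less)
  have erg: "ergodic_interval N \<xi> A" if "A \<in> R" for A
    using cover that by (simp add: ergodic_cover_def)
  obtain L where L: "ergodic_interval N \<xi> L" "I \<union> I' \<subseteq> L"
    using ergodic_intervals_Un[OF \<xi> N erg[OF I(1)] erg[OF I(2)] meet] by blast
  have "R \<subseteq> Pow (torus N)" using ergodic_interval_subset_torus[OF erg N] by blast
  then have fin: "finite R" by (rule finite_subset) (simp add: torus_def)
  let ?S = "insert L (R - {I, I'})"
  have "ergodic_cover N \<xi> ?S"
    unfolding ergodic_cover_def
  proof
    show "\<forall>A\<in>?S. ergodic_interval N \<xi> A" using erg L(1) by simp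
    have "\<Union>R \<subseteq> \<Union>?S"
    proof
      fix z assume "z \<in> \<Union>R"
      then obtain B where B: "B \<in> R" "z \<in> B" by blast
      show "z \<in> \<Union>?S"
      proof (cases "B = I \<or> B = I'")
        case True
        then have "z \<in> L" using B(2) L(2) by blast
        then show ?thesis by simp
      next
        case False
        then show ?thesis using B by blast
      qed
    qed
    then show "{x \<in> torus N. \<xi> x = 1} \<subseteq> \<Union>?S"
      using cover unfolding ergodic_cover_def by (meson order_trans)
  qed
  then have "card R \<le> card ?S" by (rule least)
  also have "\<dots> \<le> Suc (card (R - {I, I'}))" by (rule card_insert_le_m1) auto
  also have "card (R - {I, I'}) = card R - 2"
    using I fin by (subst card_Diff_subset) auto
  finally have "card R < 2" by linarith
  moreover have "card {I, I'} \<le> card R" using I fin by (intro card_mono) auto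
  ultimately show False using I(3) by simp
qed

lemma hole_map_locate:
  assumes x: "hole_map N M x" and N: "0 < N" and w: "w \<notin> range x"
  obtains i where "x i < w" "w < x (i + 1)"
proof -
  have ge: "x i + int n \<le> x (i + int n)" for i n
  proof (induction n)
    case (Suc n)
    have "x (i + int n) < x (i + int n + 1)" using hole_map_mono[OF x] by simp
    then show ?case using Suc by (simp add: algebra_simps)
  qed simp
  define n where "n = \<bar>x 0 - w\<bar> + 1"
  \<comment> \<open>An index so far to the left that its hole lies below \<open>w\<close>.\<close>
  define i0 where "i0 = (- n) * int M"
  have "x i0 = x 0 + (- n) * int N"
    using hole_map_mult[OF x, of 0 "- n"] by (simp only: i0_def add_0)
  also have "\<dots> \<le> x 0 + (- n) * 1"
    using N by (intro add_left_mono mult_left_mono_neg) (auto simp: n_def)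
  also have "\<dots> < w" by (simp add: n_def)
  finally have i0: "x i0 < w" .
  let ?S = "{i\<in>{i0..i0 + (w - x i0)}. x i < w}"
  have fin: "finite ?S" by (rule finite_subset[of _ "{i0..i0 + (w - x i0)}"]) auto
  have ne: "i0 \<in> ?S" using i0 by simp
  define i where "i = Max ?S"
  have i: "i \<in> ?S" unfolding i_def by (rule Max_in[OF fin]) (use ne in blast)
  have "\<not> x (i + 1) < w"
  proof
    assume lt: "x (i + 1) < w"
    have "x i0 + int (nat (i + 1 - i0)) \<le> x (i0 + int (nat (i + 1 - i0)))" by (rule ge)
    then have "x i0 + (i + 1 - i0) \<le> x (i + 1)" using i by simp
    then have "i + 1 \<in> ?S" using lt i by simp
    then have "i + 1 \<le> i" using Max_ge[OF fin, of "i + 1"] by (simp only: i_def)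
    then show False by simp
  qed
  moreover have "x (i + 1) \<noteq> w" using w by blast
  ultimately have "w < x (i + 1)" by linarith
  then show ?thesis using i that by blast
qed

text \<open>
  The run lengths after deletion of all particles outside \<open>U\<close>, with all holes kept.
\<close>
definition restricted_gaps :: "nat \<Rightarrow> (int \<Rightarrow> int) \<Rightarrow> int set \<Rightarrow> int \<Rightarrow> nat" where
  "restricted_gaps N x U i = card {w. x i < w \<and> w < x (i + 1) \<and> w mod int N \<in> U}"

lemma finite_run: "finite {w. a < w \<and> w < b \<and> P w}" for a b :: int
  by (rule finite_subset[of _ "{a..b}"]) auto

lemma restricted_gaps_le: "restricted_gaps N x U \<le> gaps x"
proof (rule le_funI)
  fix i
  have "card {w. x i < w \<and> w < x (i + 1) \<and> w mod int N \<in> U} \<le> card {x i<..<x (i + 1)}"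
    by (rule card_mono) auto
  then show "restricted_gaps N x U i \<le> gaps x i" by (simp add: restricted_gaps_def gaps_def)
qed

lemma restricted_gaps_pos_iff:
  "0 < restricted_gaps N x U i \<longleftrightarrow> (\<exists>w. x i < w \<and> w < x (i + 1) \<and> w mod int N \<in> U)"
  using finite_run by (auto simp: restricted_gaps_def card_gt_0_iff)

lemma restricted_gaps_periodic:
  assumes "hole_map N M x"
  shows "periodic M (restricted_gaps N x U)"
  unfolding periodic_def
proof
  fix i
  have eq: "x (i + int M) = x i + int N" "x (i + int M + 1) = x (i + 1) + int N"
    using hole_map_mult[OF assms, of i 1] hole_map_mult[OF assms, of "i + 1" 1]
    by (simp_all add: algebra_simps)
  have "bij_betw (\<lambda>w. w + int N) {w. x i < w \<and> w < x (i + 1) \<and> w mod int N \<in> U}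
     {w. x i + int N < w \<and> w < x (i + 1) + int N \<and> w mod int N \<in> U}"
    by (rule bij_betw_byWitness[where f' = "\<lambda>w. w - int N"]) auto
  from bij_betw_same_card[OF this]
  show "restricted_gaps N x U (i + int M) = restricted_gaps N x U i"
    unfolding restricted_gaps_def eq by (rule sym)
qed

lemma card_le_sum_restricted_gaps:
  assumes x: "hole_map N M x" and N: "0 < N" and M: "0 < M" and U: "U \<subseteq> torus N"
  shows "card {z\<in>U. z \<notin> range x} \<le> (\<Sum>i\<in>{0..<int M}. restricted_gaps N x U i)"
proof -
  let ?S = "Sigma {0..<int M} (\<lambda>i. {w. x i < w \<and> w < x (i + 1) \<and> w mod int N \<in> U})"
  have fin: "finite ?S" by (intro finite_SigmaI finite_run) simp
  have "{z\<in>U. z \<notin> range x} \<subseteq> (\<lambda>(i, w). w mod int N) ` ?S"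
  proof
    fix z assume z: "z \<in> {z\<in>U. z \<notin> range x}"
    then obtain i where i: "x i < z" "z < x (i + 1)" using hole_map_locate[OF x N] by blast
    define y where "y = - (i div int M)"
    have im: "i mod int M = i + y * int M"
      using div_mult_mod_eq[of i "int M"] unfolding y_def by (simp add: algebra_simps)
    have "x (i mod int M) = x i + y * int N" "x (i mod int M + 1) = x (i + 1) + y * int N"
      using hole_map_mult[OF x, of i y] hole_map_mult[OF x, of "i + 1" y] unfolding im
      by (simp_all add: algebra_simps)
    moreover have "(z + y * int N) mod int N = z" using z U by (auto simp: torus_def)
    ultimately show "z \<in> (\<lambda>(i, w). w mod int N) ` ?S"
      using i z M by (intro image_eqI[of _ _ "(i mod int M, z + y * int N)"]) auto
  qed
  then have "card {z\<in>U. z \<notin> range x} \<le> card ?S" by (rule surj_card_le[OF fin])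
  also have "\<dots> = (\<Sum>i\<in>{0..<int M}. restricted_gaps N x U i)"
    unfolding restricted_gaps_def by (rule card_SigmaI) (auto intro: finite_run)
  finally show ?thesis .
qed

text \<open>
  Within an ergodic interval the site after a hole is occupied, so each run between two of its
  particles contains a particle of the interval.
\<close>
lemma restricted_gaps_joined:
  assumes x: "hole_map N M x" and N: "0 < N" and seg: "segment N (config_of N x) u v"
    and U: "(\<lambda>w. w mod int N) ` {u..v} \<subseteq> U"
    and c: "x c < u" "u < x (c + 1)" and i: "x i < w" "w < x (i + 1)" "w mod int N = t mod int N" "u \<le> t" "t \<le> v"
  shows "\<exists>z. joined (restricted_gaps N x U) i (c + z * int M)"
proof -
  obtain z where z: "w = t + z * int N" using i(3) by (metis mod_eqE mult.commute)
  define u' v' c' where "u' = u + z * int N" and "v' = v + z * int N" and "c' = c + z * int M"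
  have seg': "segment N (config_of N x) u' v'"
    unfolding u'_def v'_def by (rule segment_shift[OF seg])
  have c': "x c' < u'" "u' < x (c' + 1)"
    using c hole_map_mult[OF x, of c z] hole_map_mult[OF x, of "c + 1" z]
    by (simp_all add: c'_def u'_def algebra_simps)
  have w: "u' \<le> w" "w \<le> v'" using i z by (simp_all add: u'_def v'_def)
  have U': "y mod int N \<in> U" if "u' \<le> y" "y \<le> v'" for y
  proof -
    have "(y - z * int N) mod int N \<in> U" using that U by (auto simp: u'_def v'_def)
    moreover have "(y - z * int N) mod int N = y mod int N"
      by (metis diff_add_cancel mod_mult_self1)
    ultimately show ?thesis by simp
  qed
  have "x c' < x (i + 1)" using c' w i by linarith
  then have ci: "c' \<le> i" using hole_map_less_iff[OF x, of c' "i + 1"] by simp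
  have "0 < restricted_gaps N x U l" if l: "c' \<le> l" "l \<le> i" for l
  proof (cases "l = c'")
    case True
    then show ?thesis unfolding restricted_gaps_pos_iff using c' U'[of u'] w by force
  next
    case False
    then have "x (c' + 1) \<le> x l"
      using l hole_map_mono[OF x, of "c' + 1" l] by (cases "l = c' + 1") auto
    moreover have "x l \<le> x i" using l hole_map_mono[OF x, of l i] by (cases "l = i") auto
    ultimately have xl: "u' \<le> x l" "x l < v'" using c' i w by linarith+
    have "config_of N x (x l mod int N) = 0" using config_of_mod[OF x N] by simp
    moreover have "1 \<le> config_of N x (x l mod int N) + config_of N x ((x l + 1) mod int N)"
      using seg' xl unfolding segment_def by blast
    ultimately have "x l + 1 \<notin> range x"
      using config_of_mod[OF x N, of "x l + 1"] by (auto split: if_splits)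
    then have "x (l + 1) \<noteq> x l + 1" by (metis rangeI)
    moreover have "x l < x (l + 1)" using hole_map_mono[OF x] by simp
    ultimately have "x l + 1 < x (l + 1)" by linarith
    then show ?thesis
      unfolding restricted_gaps_pos_iff using U'[of "x l + 1"] xl by (intro exI[of _ "x l + 1"]) auto
  qed
  then have "joined (restricted_gaps N x U) i c'"
    using ci by (simp add: joined_def)
  then show ?thesis unfolding c'_def by blast
qed

text \<open>
  The anchors are the runs that contain the left end points of the chosen regions.
\<close>
lemma few_regions_anchored:
  assumes \<xi>: "config_of N x \<in> few_regions_configs m N k" and x: "hole_map N M x"
    and N: "0 < N" and M: "0 < M" and k: "k + M = N"
  obtains C \<zeta> where "finite C" "card C \<le> m" "\<zeta> \<in> anchored M C" "\<zeta> \<le> gaps x"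
proof -
  let ?\<xi> = "config_of N x"
  obtain R J where non: "?\<xi> \<in> nonergodic N k" and R: "is_ergodic_regions N ?\<xi> R"
    and J: "J \<subseteq> R" "card J \<le> m" and many: "int (\<Sum>I\<in>J. \<Sum>z\<in>I. ?\<xi> z) \<ge> int N - int k"
    using \<xi> by (auto simp: few_regions_configs_def)
  have erg: "ergodic_interval N ?\<xi> I" if "I \<in> R" for I
    using R that by (auto simp: is_ergodic_regions_def is_arg_min_def ergodic_cover_def)
  have tor: "I \<subseteq> torus N" if "I \<in> R" for I by (rule ergodic_interval_subset_torus[OF erg[OF that] N])
  have finJ: "finite J"
    by (rule finite_subset[of _ "Pow (torus N)"]) (use J tor in \<open>auto simp: torus_def\<close>)
  let ?U = "\<Union>J"
  have U: "?U \<subseteq> torus N" using J tor by blast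
  have finI: "finite I" if "I \<in> J" for I
    by (rule finite_subset[of _ "torus N"]) (use tor J that in \<open>auto simp: torus_def\<close>)
  have "(\<Sum>I\<in>J. \<Sum>z\<in>I. ?\<xi> z) = (\<Sum>z\<in>?U. ?\<xi> z)"
    using finJ finI ergodic_regions_disjoint[OF non N R] J
    by (subst sum.Union_disjoint) (auto simp: comp_def)
  also have "\<dots> = (\<Sum>z\<in>{z\<in>?U. z \<notin> range x}. 1)"
    by (rule sum.mono_neutral_cong_right) (use finJ finI U in \<open>auto simp: config_of_def\<close>)
  finally have "M \<le> card {z\<in>?U. z \<notin> range x}" using many k by simp
  define \<zeta> where "\<zeta> = restricted_gaps N x ?U"
  have sum: "M \<le> (\<Sum>i\<in>{0..<int M}. \<zeta> i)"
    unfolding \<zeta>_def using card_le_sum_restricted_gaps[OF x N M U] \<open>M \<le> _\<close> by linarith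
  have "\<exists>c u v. segment N ?\<xi> u v \<and> I = (\<lambda>w. w mod int N) ` {u..v} \<and> x c < u \<and> u < x (c + 1)"
    if IJ: "I \<in> J" for I
  proof -
    have IR: "I \<in> R" using IJ J(1) by blast
    obtain u v where uv: "segment N ?\<xi> u v" "I = (\<lambda>w. w mod int N) ` {u..v}"
      by (rule ergodic_interval_imp_segment[OF erg[OF IR] N])
    have "?\<xi> (u mod int N) = 1" using uv(1) by (simp add: segment_def)
    then have "u \<notin> range x" using config_of_mod[OF x N, of u] by (metis zero_neq_one)
    then obtain c where "x c < u" "u < x (c + 1)" using hole_map_locate[OF x N] by blast
    then show ?thesis using uv by metis
  qed
  then obtain c u v where cuv: "\<And>I. I \<in> J \<Longrightarrow> segment N ?\<xi> (u I) (v I)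
      \<and> I = (\<lambda>w. w mod int N) ` {u I..v I} \<and> x (c I) < u I \<and> u I < x (c I + 1)"
    by metis
  have pos: "0 < \<zeta> (c I)" if "I \<in> J" for I
  proof -
    have "u I mod int N \<in> I" using cuv[OF that] by (auto simp: segment_def)
    then show ?thesis unfolding \<zeta>_def restricted_gaps_pos_iff using cuv[OF that] that by blast
  qed
  have "\<exists>a\<in>c ` J. \<exists>z. joined \<zeta> i (a + z * int M)" if i: "0 < \<zeta> i" for i
  proof -
    obtain w I where w: "x i < w" "w < x (i + 1)" "w mod int N \<in> I" "I \<in> J"
      using i unfolding \<zeta>_def restricted_gaps_pos_iff by blast
    note I = cuv[OF w(4)]
    obtain t where t: "w mod int N = t mod int N" "u I \<le> t" "t \<le> v I"
      using w(3) I by (metis (no_types, lifting) atLeastAtMost_iff imageE)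
    have seg: "segment N ?\<xi> (u I) (v I)" and loc: "x (c I) < u I" "u I < x (c I + 1)"
      using I by simp_all
    have "I = (\<lambda>w. w mod int N) ` {u I..v I}" using I by simp
    then have "(\<lambda>w. w mod int N) ` {u I..v I} \<subseteq> ?U" using w(4) by (metis Union_upper)
    from restricted_gaps_joined[OF x N seg this loc w(1,2) t]
    show ?thesis
      unfolding \<zeta>_def using w(4) by blast
  qed
  then have "\<zeta> \<in> anchored M (c ` J)"
    using sum pos restricted_gaps_periodic[OF x] by (auto simp: anchored_def \<zeta>_def)
  moreover have "card (c ` J) \<le> m" using card_image_le[OF finJ, of c] J(2) by linarith
  moreover have "\<zeta> \<le> gaps x" unfolding \<zeta>_def by (rule restricted_gaps_le)
  ultimately show ?thesis using finJ that by blast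
qed

section \<open>From averaged moves to the semigroup\<close>

lemma hop_mean_has_gap_le:
  assumes "0 < M"
  shows "hop_mean M has_gap \<eta> \<le> has_gap \<eta>"
proof -
  have le: "has_gap (hop M r d \<eta>) \<le> has_gap \<eta>" for r d
  proof (cases "\<exists>i. \<eta> i = 0")
    case False
    then have "0 < hop M r d \<eta> i" for i by (metis gr0I hop_pos)
    then show ?thesis using False by (auto simp: has_gap_def)
  qed (simp add: has_gap_def)
  have "hop_mean M has_gap \<eta> \<le> (\<Sum>r\<in>{0..<int M}. has_gap \<eta> + has_gap \<eta>) / (2 * real M)"
    unfolding hop_mean_def by (intro divide_right_mono sum_mono add_mono le) simp
  also have "\<dots> = has_gap \<eta>" using assms by simp
  finally show ?thesis .
qed

lemma hop_mean_power_has_gap_decreasing: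
  assumes "0 < M" "l \<le> n"
  shows "(hop_mean M ^^ n) has_gap \<eta> \<le> (hop_mean M ^^ l) has_gap \<eta>"
  using assms(2)
proof (induction n rule: dec_induct)
  case (step n)
  have "(hop_mean M ^^ Suc n) has_gap \<eta> = (hop_mean M ^^ n) (hop_mean M has_gap) \<eta>"
    by (simp add: funpow_swap1)
  also have "\<dots> \<le> (hop_mean M ^^ n) has_gap \<eta>"
    by (rule hop_mean_power_le[of M UNIV]) (auto simp: hop_closed_def hop_mean_has_gap_le[OF assms(1)])
  finally show ?case using step by linarith
qed simp

text \<open>
  The bound for stages of length \<open>n div m\<close>, written as a pure power in
  \<open>n\<close> so that it can be summed against Poisson weights; Bernoulli's inequality
  extracts the \<open>m\<close>-th root of the contraction factor, and the remainder of the
  division costs a factor 2.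
\<close>
lemma gap_bound:
  assumes M: "0 < M" and m: "0 < m" and K: "12 * (2 * real M + 1)^2 \<le> K"
    and C: "finite C" "card C \<le> m" "\<eta> \<in> anchored M C"
  shows "(hop_mean M ^^ n) has_gap \<eta> \<le> 8 * real m^2 * real M * (1 - 1 / (real m * real M * K)) ^ n"
proof -
  define \<rho> where "\<rho> = 1 / (real M * K)"
  define \<theta> where "\<theta> = 1 - \<rho> / real m"
  define l where "l = n div m"
  have "1 \<le> (2 * real M + 1)^2" by (simp add: one_le_power)
  then have "2 \<le> K" using K by linarith
  then have "1 * 2 \<le> real M * K" using M by (intro mult_mono) auto
  then have \<rho>: "0 \<le> \<rho>" "\<rho> \<le> 1 / 2"
    by (simp_all add: \<rho>_def field_simps)
  have "\<rho> / real m \<le> \<rho> / 1" using \<rho> m by (intro divide_left_mono) auto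
  then have \<theta>: "0 \<le> \<theta>" "\<theta> \<le> 1" using \<rho> by (simp_all add: \<theta>_def)
  have bern: "1 - \<rho> \<le> \<theta> ^ m"
    using Bernoulli_inequality[of "- \<rho> / real m" m] m \<theta> by (simp add: \<theta>_def)
  have "l * card C \<le> l * m" using C(2) by simp
  also have "\<dots> \<le> n" by (simp add: l_def)
  finally have "(hop_mean M ^^ n) has_gap \<eta> \<le> (hop_mean M ^^ (l * card C)) has_gap \<eta>"
    by (rule hop_mean_power_has_gap_decreasing[OF M])
  also have "\<dots> \<le> real (card C)^2 * (4 * real M * (1 - \<rho>) ^ l)"
    unfolding \<rho>_def by (rule gap_bound_stages[OF M K C(1,3)])
  also have "\<dots> \<le> real m^2 * (4 * real M * (1 - \<rho>) ^ l)"
    using C(2) \<rho> by (intro mult_right_mono power_mono) auto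
  also have "\<dots> \<le> real m^2 * (4 * real M * (2 * \<theta> ^ n))"
  proof -
    have "\<theta> ^ m \<le> \<theta> ^ (n mod m)"
      using \<theta> m by (intro power_decreasing) (auto simp: less_imp_le)
    then have "1 / 2 \<le> \<theta> ^ (n mod m)" using bern \<rho> by linarith
    then have "\<theta> ^ (l * m) * (1 / 2) \<le> \<theta> ^ (l * m) * \<theta> ^ (n mod m)"
      using \<theta> by (intro mult_left_mono) auto
    also have "\<dots> = \<theta> ^ n" unfolding l_def by (simp flip: power_add)
    finally have "\<theta> ^ (l * m) \<le> 2 * \<theta> ^ n" by simp
    moreover have "(1 - \<rho>) ^ l \<le> (\<theta> ^ m) ^ l" using bern \<rho> by (intro power_mono) auto
    ultimately have "(1 - \<rho>) ^ l \<le> 2 * \<theta> ^ n" by (simp add: mult.commute flip: power_mult)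
    then show ?thesis by (intro mult_left_mono) auto
  qed
  finally show ?thesis by (simp add: \<theta>_def \<rho>_def mult_ac)
qed

text \<open>
  The \<open>n\<close>-th forward difference of \<open>q\<close> at 0; it expands the
  \<open>n\<close>-th power of \<open>Q - 1\<close>.
\<close>
definition alt_binomial_sum :: "nat \<Rightarrow> (nat \<Rightarrow> real) \<Rightarrow> real" where
  "alt_binomial_sum n q = (\<Sum>j\<le>n. real (n choose j) * (-1) ^ (n - j) * q j)"

lemma alt_binomial_sum_Suc:
  "alt_binomial_sum (Suc n) q = alt_binomial_sum n (\<lambda>j. q (Suc j)) - alt_binomial_sum n q"
proof -
  have "alt_binomial_sum (Suc n) q
      = (-1) ^ Suc n * q 0 + (\<Sum>j\<le>n. real (Suc n choose Suc j) * (-1) ^ (n - j) * q (Suc j))"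
    unfolding alt_binomial_sum_def by (subst sum.atMost_Suc_shift) simp
  also have "(\<Sum>j\<le>n. real (Suc n choose Suc j) * (-1) ^ (n - j) * q (Suc j))
      = alt_binomial_sum n (\<lambda>j. q (Suc j)) + (\<Sum>j\<le>n. real (n choose Suc j) * (-1) ^ (n - j) * q (Suc j))"
    by (simp add: alt_binomial_sum_def sum.distrib distrib_right)
  also have "(-1) ^ Suc n * q 0 + (alt_binomial_sum n (\<lambda>j. q (Suc j))
        + (\<Sum>j\<le>n. real (n choose Suc j) * (-1) ^ (n - j) * q (Suc j)))
      = alt_binomial_sum n (\<lambda>j. q (Suc j)) + (\<Sum>j\<le>Suc n. real (n choose j) * (-1) ^ (Suc n - j) * q j)"
    by (subst sum.atMost_Suc_shift) simp
  also have "(\<Sum>j\<le>Suc n. real (n choose j) * (-1) ^ (Suc n - j) * q j) = - alt_binomial_sum n q"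
    by (simp add: alt_binomial_sum_def sum_negf[symmetric] Suc_diff_le)
  finally show ?thesis by simp
qed

lemma alt_binomial_sum_diff:
  "alt_binomial_sum n (\<lambda>j. c * (p j - q j)) = c * (alt_binomial_sum n p - alt_binomial_sum n q)"
  by (simp add: alt_binomial_sum_def sum_distrib_left sum_subtractf[symmetric] algebra_simps)

lemma generator_power_expansion:
  "((\<lambda>h \<eta>. c * (hop_mean M h \<eta> - h \<eta>)) ^^ n) g \<eta>
    = c ^ n * alt_binomial_sum n (\<lambda>j. (hop_mean M ^^ j) g \<eta>)"
proof (induction n arbitrary: g)
  case 0
  then show ?case by (simp add: alt_binomial_sum_def)
next
  case (Suc n)
  let ?A = "\<lambda>h \<eta>. c * (hop_mean M h \<eta> - h \<eta>)"
  have lin: "(hop_mean M ^^ j) (?A g) = (\<lambda>\<eta>. c * ((hop_mean M ^^ Suc j) g \<eta> - (hop_mean M ^^ j) g \<eta>))" for j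
  proof -
    have "?A g = (\<lambda>\<eta>. c * (hop_mean M g \<eta> + (-1) * g \<eta>))" by (rule ext) simp
    then have "(hop_mean M ^^ j) (?A g)
        = (\<lambda>\<eta>. c * ((hop_mean M ^^ j) (hop_mean M g) \<eta> + (-1) * (hop_mean M ^^ j) g \<eta>))"
      by (simp only: hop_mean_power_cmult hop_mean_power_add)
    then show ?thesis by (simp add: funpow_swap1)
  qed
  have "(?A ^^ Suc n) g \<eta> = (?A ^^ n) (?A g) \<eta>"
    by (simp only: funpow_Suc_right comp_apply)
  also have "\<dots> = c ^ n * alt_binomial_sum n (\<lambda>j. (hop_mean M ^^ j) (?A g) \<eta>)" by (rule Suc.IH)
  also have "\<dots> = c ^ Suc n * alt_binomial_sum (Suc n) (\<lambda>j. (hop_mean M ^^ j) g \<eta>)"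
    unfolding lin alt_binomial_sum_diff alt_binomial_sum_Suc by (simp add: mult_ac)
  finally show ?case .
qed

text \<open>
  The identity \<open>exp (s * (Q - 1)) = exp (- s) * exp (s * Q)\<close>, read off from the
  Cauchy product of the two series.
\<close>
lemma poisson_mixture:
  fixes q :: "nat \<Rightarrow> real"
  assumes q: "\<And>j. \<bar>q j\<bar> \<le> 1"
  shows "(\<lambda>n. s ^ n / fact n * alt_binomial_sum n q) sums (exp (- s) * (\<Sum>j. s ^ j / fact j * q j))"
proof -
  define a where "a = (\<lambda>j. s ^ j / fact j * q j)"
  define b where "b = (\<lambda>i. (- s) ^ i / fact i)"
  have "summable (\<lambda>j. \<bar>s\<bar> ^ j / fact j)"
    using summable_exp_generic[of "\<bar>s\<bar>"] by (simp add: divide_inverse mult.commute scaleR_conv_of_real)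
  moreover have "norm (norm (a j)) \<le> \<bar>s\<bar> ^ j / fact j" for j
    using q[of j] by (simp add: a_def abs_mult power_abs mult_left_le divide_right_mono)
  ultimately have sa: "summable (\<lambda>j. norm (a j))" by (rule summable_comparison_test'[where N = 0])
  have sb: "summable (\<lambda>i. norm (b i))"
    using summable_norm_exp[of "- s"] by (simp add: b_def divide_inverse mult.commute)
  have eb: "suminf b = exp (- s)"
    by (simp add: b_def exp_def divide_inverse mult.commute)
  have "(\<Sum>j\<le>n. a j * b (n - j)) = s ^ n / fact n * alt_binomial_sum n q" for n
    unfolding alt_binomial_sum_def sum_distrib_left
  proof (rule sum.cong)
    fix j assume "j \<in> {..n}"
    then have j: "j \<le> n" by simp
    have "(- s) ^ (n - j) = (- 1) ^ (n - j) * s ^ (n - j)" by (rule power_minus)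
    moreover have "s ^ n = s ^ j * s ^ (n - j)" using j by (simp flip: power_add)
    ultimately show "a j * b (n - j) = s ^ n / fact n * (real (n choose j) * (-1) ^ (n - j) * q j)"
      by (simp add: a_def b_def binomial_fact[OF j] field_simps)
  qed simp
  then show ?thesis
    using Cauchy_product_sums[OF sa sb] eb by (simp add: a_def mult.commute)
qed

lemma sfep_law_bound:
  assumes \<xi>: "\<xi> \<in> few_regions_configs m N k" and m: "0 < m" and N: "0 < N" and M: "0 < M" and k: "k + M = N"
    and K: "12 * (2 * real M + 1)^2 \<le> K" and t: "0 \<le> t"
  shows "sfep_law N t \<xi> (nonergodic N k) \<le> 8 * real m^2 * real M * exp (- t / (real m * K))"
proof -
  have "\<xi> \<in> configs N k" using \<xi> by (simp add: few_regions_configs_def nonergodic_def)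
  then obtain x where x: "hole_map N M x" "config_of N x = \<xi>"
    using exists_hole_map[OF _ N M k] by blast
  obtain C \<zeta> where C: "finite C" "card C \<le> m" "\<zeta> \<in> anchored M C" and le: "\<zeta> \<le> gaps x"
    using few_regions_anchored[OF _ x(1) N M k] \<xi> x(2) by blast
  define q where "q = (\<lambda>j. (hop_mean M ^^ j) has_gap (gaps x))"
  define \<theta> where "\<theta> = 1 - 1 / (real m * real M * K)"
  define s where "s = real M * t"
  define B where "B = 8 * real m^2 * real M"
  have s: "0 \<le> s" using t by (simp add: s_def)
  have K0: "0 < K"
  proof -
    have "1 \<le> (2 * real M + 1)^2" by (simp add: one_le_power)
    then show ?thesis using K by linarith
  qed
  have q0: "0 \<le> q j" for j
  proof -
    have "(hop_mean M ^^ j) (\<lambda>_. 0) (gaps x) \<le> q j"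
      unfolding q_def by (rule hop_mean_power_le[of M UNIV]) (auto simp: hop_closed_def has_gap_def)
    then show ?thesis using M by (simp add: hop_mean_power_const)
  qed
  have q1: "q j \<le> 1" for j unfolding q_def by (rule hop_mean_power_has_gap_le_1[OF M])
  have qB: "q j \<le> B * \<theta> ^ j" for j
  proof -
    have "q j \<le> (hop_mean M ^^ j) has_gap \<zeta>"
      unfolding q_def by (rule hop_mean_power_antimono[OF has_gap_antimono le])
    also have "\<dots> \<le> B * \<theta> ^ j"
      unfolding B_def \<theta>_def by (rule gap_bound[OF M m K C])
    finally show ?thesis .
  qed
  have "t ^ n / fact n * (sfep_generator N ^^ n) (indicator (nonergodic N k)) \<xi>
      = s ^ n / fact n * alt_binomial_sum n q" for n
    using sfep_generator_power_config_of[of N M "indicator (nonergodic N k)" has_gap x n,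
        OF N M indicator_nonergodic_config_of[OF _ N M k] x(1)]
    unfolding x(2) generator_power_expansion q_def s_def by (simp add: power_mult_distrib)
  moreover have "(\<lambda>n. s ^ n / fact n * alt_binomial_sum n q) sums (exp (- s) * (\<Sum>j. s ^ j / fact j * q j))"
    using q0 q1 by (intro poisson_mixture) simp
  ultimately have "sfep_law N t \<xi> (nonergodic N k) = exp (- s) * (\<Sum>j. s ^ j / fact j * q j)"
    unfolding sfep_law_def sfep_semigroup_def by (simp add: sums_unique[symmetric])
  also have "(\<Sum>j. s ^ j / fact j * q j) \<le> (\<Sum>j. B * ((s * \<theta>) ^ j / fact j))"
  proof (rule suminf_le)
    show le: "s ^ j / fact j * q j \<le> B * ((s * \<theta>) ^ j / fact j)" for j
    proof -
      have "s ^ j / fact j * q j \<le> s ^ j / fact j * (B * \<theta> ^ j)"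
        using qB s by (intro mult_left_mono) auto
      then show ?thesis by (simp add: power_mult_distrib mult_ac)
    qed
    show sum: "summable (\<lambda>j. B * ((s * \<theta>) ^ j / fact j))"
      using summable_exp_generic[of "s * \<theta>"]
      by (intro summable_mult) (simp add: divide_inverse mult.commute)
    show "summable (\<lambda>j. s ^ j / fact j * q j)"
      by (rule summable_comparison_test'[OF sum]) (use le q0 s in auto)
  qed
  also have "\<dots> = B * exp (s * \<theta>)"
  proof -
    have "summable (\<lambda>j. (s * \<theta>) ^ j / fact j)"
      using summable_exp_generic[of "s * \<theta>"] by (simp add: divide_inverse mult.commute)
    then show ?thesis
      by (subst suminf_mult) (simp_all add: exp_def divide_inverse mult.commute)
  qed
  also have "exp (- s) * (B * exp (s * \<theta>)) = B * exp (- s + s * \<theta>)"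
    by (simp only: exp_add mult_ac)
  also have "- s + s * \<theta> = - t / (real m * K)"
    using M m K0 by (simp add: \<theta>_def s_def field_simps)
  finally show ?thesis by (simp add: B_def)
qed

lemma nonergodic_full_empty: "nonergodic N N = {}"
proof -
  have "\<xi> \<in> ergodic_component N N" if \<xi>: "\<xi> \<in> configs N N" for \<xi>
  proof -
    have le: "\<xi> z \<le> 1" if "z \<in> torus N" for z
      using \<xi> that by (fastforce simp: configs_def PiE_def Pi_def)
    have fin: "finite (torus N)" and card: "card (torus N) = N" by (simp_all add: torus_def)
    have "\<xi> z = 1" if z: "z \<in> torus N" for z
    proof (rule ccontr)
      assume ne: "\<xi> z \<noteq> 1"
      have "(\<Sum>z\<in>torus N. \<xi> z) < (\<Sum>z\<in>torus N. 1)"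
      proof (rule sum_strict_mono_ex1[OF fin])
        show "\<forall>z\<in>torus N. \<xi> z \<le> 1" using le by blast
        have "\<xi> z < 1" using le[OF z] ne by linarith
        then show "\<exists>z\<in>torus N. \<xi> z < 1" using z by blast
      qed
      then show False using \<xi> card by (simp add: configs_def)
    qed
    then show ?thesis using \<xi> by (simp add: ergodic_component_def)
  qed
  then show ?thesis by (auto simp: nonergodic_def)
qed

lemma finite_configs: "finite (configs N k)"
  by (rule finite_subset[of _ "torus N \<rightarrow>\<^sub>E {0, 1}"])
     (auto simp: configs_def torus_def intro: finite_PiE)

theorem proposition2p4:
  fixes m :: nat
  assumes "m > 0"
  shows "\<exists>C::real. C > 0 \<and>
    (\<forall>k :: nat \<Rightarrow> nat. (\<forall>N\<ge>1. real N / 2 < real (k N) \<and> k N \<le> N) \<longrightarrow>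
      (\<forall>\<epsilon>::real. \<epsilon> > 0 \<longrightarrow>
        (\<exists>N0. \<forall>N\<ge>N0.
          max_over (few_regions_configs m N (k N))
            (\<lambda>\<xi>. sfep_law N (C * real N ^ 2 * ln (real N)) \<xi> (nonergodic N (k N))) < \<epsilon>)))"
\<comment> \<open>With \<open>K = 12 * N^2\<close> the exponent \<open>- t / (m * K)\<close> becomes \<open>- 2 * ln N\<close>.\<close>
proof (rule exI[of _ "24 * real m"], intro conjI allI impI)
  show "0 < 24 * real m" using assms by simp
  fix k :: "nat \<Rightarrow> nat" and \<epsilon> :: real
  assume k: "\<forall>N\<ge>1. real N / 2 < real (k N) \<and> k N \<le> N" and \<epsilon>: "0 < \<epsilon>"
  define N0 where "N0 = nat \<lceil>4 * real m^2 / \<epsilon>\<rceil> + 1"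
  have "max_over (few_regions_configs m N (k N))
      (\<lambda>\<xi>. sfep_law N (24 * real m * real N ^ 2 * ln (real N)) \<xi> (nonergodic N (k N))) < \<epsilon>"
    if "N0 \<le> N" for N
  proof -
    have N: "0 < N" "4 * real m^2 / \<epsilon> < real N"
      using that unfolding N0_def by linarith+
    let ?F = "few_regions_configs m N (k N)"
    let ?t = "24 * real m * real N ^ 2 * ln (real N)"
    have kN: "real N / 2 < real (k N)" "k N \<le> N" using k N by auto
    have bound: "sfep_law N ?t \<xi> (nonergodic N (k N)) < \<epsilon>" if \<xi>: "\<xi> \<in> ?F" for \<xi>
    proof -
      define M where "M = N - k N"
      have "k N \<noteq> N"
      proof
        assume "k N = N"
        then show False using \<xi> nonergodic_full_empty by (auto simp: few_regions_configs_def)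
      qed
      then have M: "0 < M" "k N + M = N" using kN by (simp_all add: M_def)
      \<comment> \<open>The density assumption: fewer than half of the sites are holes.\<close>
      have "2 * M < N" using kN M by linarith
      then have MN: "2 * real M + 1 \<le> real N" by linarith
      have t: "0 \<le> ?t" using N by (intro mult_nonneg_nonneg) auto
      have K: "12 * (2 * real M + 1)^2 \<le> 12 * real N ^ 2"
        using MN by (intro mult_left_mono power_mono) auto
      have "sfep_law N ?t \<xi> (nonergodic N (k N))
          \<le> 8 * real m^2 * real M * exp (- ?t / (real m * (12 * real N ^ 2)))"
        by (rule sfep_law_bound[OF \<xi> assms N(1) M K t])
      also have "- ?t / (real m * (12 * real N ^ 2)) = - (ln (real N) + ln (real N))"
        using assms N by (simp add: field_simps)
      also have "exp \<dots> = 1 / real N ^ 2"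
      proof -
        have "exp (ln (real N)) = real N" using N(1) by simp
        then show ?thesis
          by (simp only: exp_minus exp_add power2_eq_square inverse_eq_divide)
      qed
      also have "8 * real m^2 * real M * (1 / real N ^ 2) \<le> 8 * real m^2 * (real N / 2) * (1 / real N ^ 2)"
        using MN by (intro mult_right_mono mult_left_mono) auto
      also have "\<dots> = 4 * real m^2 / real N"
        using N by (simp add: power2_eq_square)
      also have "\<dots> < \<epsilon>" using N \<epsilon> by (simp add: field_simps)
      finally show ?thesis .
    qed
    have "finite ?F"
      by (rule finite_subset[OF _ finite_configs[of N "k N"]])
         (auto simp: few_regions_configs_def nonergodic_def)
    then show ?thesis
      using bound \<epsilon> unfolding max_over_def by (auto simp: Max_less_iff)
  qed
  then show "\<exists>N0. \<forall>N\<ge>N0. max_over (few_regions_configs m N (k N))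
      (\<lambda>\<xi>. sfep_law N (24 * real m * real N ^ 2 * ln (real N)) \<xi> (nonergodic N (k N))) < \<epsilon>"
    by blast
qed

end
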